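(* Let $n\geqslant 4$ and $m=\lfloor\frac{n-1}{2}\rfloor$. Let $A=\{x,y,e_1,\ldots,e_n,x_1,\ldots,x_m,y_1,\ldots,y_m\}$ be an alphabet (of $2n+\frac{1-(-1)^n}{2}$ letters) and let $R$ consist of the following $\frac12\bigl(5n^2-(1+2(-1)^n)n+(-1)^{n+1}+5\bigr)$ monoid relations on $A^*$: $(R_1)$ $e_i^2=e_i$, for $1\leqslant i\leqslant n$; $(R_2)$ $xy=e_n$ and $yx=e_1$; $(R_3)$ $xe_1=x$ and $e_1y=y$; $(R_4)$ $e_ie_j=e_je_i$, for $1\leqslant i<j\leqslant n$; $(R_5)$ $e_ix=xe_{i+1}$, for $1\leqslant i\leqslant n-1$; $(R_6)$ $x_iy_i=e_2\cdots e_ie_{i+2}\cdots e_n$ and $y_ix_i=e_2\cdots e_{n-i}e_{n-i+2}\cdots e_n$, for $1\leqslant i\leqslant m$; $(R_7)$ $x_ie_j=x_i$ and $e_jy_i=y_i$, for $1\leqslant i\leqslant m$, $2\leqslant j\leqslant n$, $j\neq n-i+1$; $(R_8)$ $e_jx_i=x_i$ and $y_ie_j=y_i$, for $1\leqslant i\leqslant m$, $2\leqslant j\leqslant n$, $j\neq i+1$; $(R_9)$ $e_1x_i=x_ie_1=x^{n-2i}e_{n-2i+1}\cdots e_{n-i}e_{n-i+2}\cdots e_n$ and $e_1y_i=y_ie_1=y^{n-2i}e_1\cdots e_ie_{i+2}\cdots e_{2i}$, for $1\leqslant i\leqslant m$; $(R_{10})$ $x_ie_{n-i+1}=e_{i+1}x_i=y_ie_{i+1}=e_{n-i+1}y_i=e_2\cdots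 e_n$, for $1\leqslant i\leqslant m$; $(R_{11})$ $xe_2\cdots e_n=e_1\cdots e_n$. Then the monoid $\mathcal{ODI}_n$ is defined by the presentation $\langle A\mid R\rangle$.
   Context: Let $\Omega_n=\{1<2<\cdots<n\}$. $\mathcal{I}_n$ is the symmetric inverse monoid of all partial permutations (injective partial maps) of $\Omega_n$ under composition; maps act on the right, so $\alpha\beta$ means first $\alpha$, then $\beta$. Let $g$ be the permutation $i\mapsto i+1$ ($1\leqslant i\leqslant n-1$), $n\mapsto 1$, and $h$ the permutation $i\mapsto n+1-i$; they generate the dihedral group $\mathcal{D}_{2n}$ of order $2n$ inside the symmetric group on $\Omega_n$. The dihedral inverse monoid $\mathcal{DI}_n$ is the submonoid of $\mathcal{I}_n$ of all restrictions (to arbitrary subsets of $\Omega_n$) of elements of $\mathcal{D}_{2n}$. An $\alpha\in\mathcal{I}_n$ is order-preserving if $a\leqslant b$ implies $a\alpha\leqslant b\alpha$ for all $a,b\in\mathrm{Dom}(\alpha)$. $\mathcal{ODI}_n$ is the monoid of all order-preserving elements of $\mathcal{DI}_n$. A monoid $M$ is defined by a presentation $\langle A\mid R\rangle$, where $R\subseteq A^*\times A^*$, if $M\cong A^*/\rho_R$, where $\rho_R$ is the smallest congruence on the free monoid $A^*$ containing $R$. Conventions: $e_a\cdots e_b$ denotes the product of the letters $e_k$, $a\leqslant k\leqslant b$, in increasing order of index, and is the empty word if $a>b$. A chain of $k$ equalities counts as $k$ relations. *)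

theory Defs
  imports Complex_Main "HOL-Algebra.Sym_Groups"
begin

section \<open>Monoid presentations\<close>

definition free_monoid :: "'a set \<Rightarrow> 'a list monoid" where
  "free_monoid A = \<lparr>carrier = lists A, mult = (@), one = []\<rparr>"

definition monoid_congruence :: "('a, 'b) monoid_scheme \<Rightarrow> ('a \<times> 'a) set \<Rightarrow> bool" where
  "monoid_congruence M r \<longleftrightarrow> equiv (carrier M) r \<and>
     (\<forall>a b c d. (a, b) \<in> r \<and> (c, d) \<in> r \<longrightarrow> (a \<otimes>\<^bsub>M\<^esub> c, b \<otimes>\<^bsub>M\<^esub> d) \<in> r)"

definition generated_congruence ::
    "('a, 'b) monoid_scheme \<Rightarrow> ('a \<times> 'a) set \<Rightarrow> ('a \<times> 'a) set" where
  "generated_congruence M R = \<Inter>{r. monoid_congruence M r \<and> R \<subseteq> r}"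

text \<open>For a congruence \<open>r\<close>, the union below is the single class of \<open>a \<otimes> b\<close>, for any
  representatives \<open>a \<in> U\<close> and \<open>b \<in> V\<close>.\<close>

definition quotient_monoid ::
    "('a, 'b) monoid_scheme \<Rightarrow> ('a \<times> 'a) set \<Rightarrow> 'a set monoid" where
  "quotient_monoid M r =
     \<lparr>carrier = carrier M // r,
      mult = (\<lambda>U V. \<Union>a\<in>U. \<Union>b\<in>V. r `` {a \<otimes>\<^bsub>M\<^esub> b}),
      one = r `` {\<one>\<^bsub>M\<^esub>}\<rparr>"

definition defined_by_presentation ::
    "('m, 'b) monoid_scheme \<Rightarrow> 'a set \<Rightarrow> ('a list \<times> 'a list) set \<Rightarrow> bool" where
  "defined_by_presentation M A R \<longleftrightarrow>
     monoid M \<and> R \<subseteq> lists A \<times> lists A \<and>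
     M \<cong> quotient_monoid (free_monoid A) (generated_congruence (free_monoid A) R)"


section \<open>The monoid of order-preserving elements of the dihedral inverse monoid\<close>

text \<open>A partial map of \<open>{1..n}\<close> is a function of type \<open>nat \<rightharpoonup> nat\<close>. Maps act on the right, so the
  product of \<open>\<alpha>\<close> and \<open>\<beta>\<close> is first \<open>\<alpha>\<close>, then \<open>\<beta>\<close>.\<close>

definition sym_inv_monoid :: "nat \<Rightarrow> (nat \<rightharpoonup> nat) monoid" where
  "sym_inv_monoid n =
     \<lparr>carrier = {\<alpha>. dom \<alpha> \<subseteq> {1..n} \<and> ran \<alpha> \<subseteq> {1..n} \<and> inj_on \<alpha> (dom \<alpha>)},
      mult = (\<lambda>\<alpha> \<beta>. \<beta> \<circ>\<^sub>m \<alpha>),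
      one = Some |` {1..n}\<rparr>"

definition cycle_perm :: "nat \<Rightarrow> nat \<Rightarrow> nat" where
  "cycle_perm n i = (if i \<in> {1..<n} then i + 1 else if i = n then 1 else i)"

definition reversal_perm :: "nat \<Rightarrow> nat \<Rightarrow> nat" where
  "reversal_perm n i = (if i \<in> {1..n} then n + 1 - i else i)"

text \<open>The library's group \<open>sym_group n\<close> composes from right to left. This does not matter here:
  the subgroup generated by a set has the same elements for either order of composition.\<close>

definition dihedral :: "nat \<Rightarrow> (nat \<Rightarrow> nat) set" where
  "dihedral n = generate (sym_group n) {cycle_perm n, reversal_perm n}"

definition dihedral_inverse_monoid :: "nat \<Rightarrow> (nat \<rightharpoonup> nat) monoid" where
  "dihedral_inverse_monoid n = (sym_inv_monoid n)
     \<lparr>carrier := {(Some \<circ> \<sigma>) |` S | \<sigma> S. \<sigma> \<in> dihedral n \<and> S \<subseteq> {1..n}}\<rparr>"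

definition order_preserving :: "(nat \<rightharpoonup> nat) \<Rightarrow> bool" where
  "order_preserving \<alpha> \<longleftrightarrow> (\<forall>a\<in>dom \<alpha>. \<forall>b\<in>dom \<alpha>. a \<le> b \<longrightarrow> the (\<alpha> a) \<le> the (\<alpha> b))"

definition ODI :: "nat \<Rightarrow> (nat \<rightharpoonup> nat) monoid" where
  "ODI n = (dihedral_inverse_monoid n)
     \<lparr>carrier := {\<alpha> \<in> carrier (dihedral_inverse_monoid n). order_preserving \<alpha>}\<rparr>"


section \<open>The alphabet and the relations\<close>

text \<open>\<open>X\<close> and \<open>Y\<close> are the letters $x$ and $y$; \<open>E i\<close>, \<open>Xi i\<close> and \<open>Yi i\<close> are
  $e_i$, $x_i$ and $y_i$.\<close>

datatype letter = X | Y | E nat | Xi nat | Yi nat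

definition alphabet :: "nat \<Rightarrow> nat \<Rightarrow> letter set" where
  "alphabet n m = {X, Y} \<union> E ` {1..n} \<union> Xi ` {1..m} \<union> Yi ` {1..m}"

text \<open>The word $e_a \cdots e_b$, empty if $a > b$.\<close>

definition es :: "nat \<Rightarrow> nat \<Rightarrow> letter list" where
  "es a b = map E [a..<Suc b]"

text \<open>A chain \<open>u\<^sub>0 = u\<^sub>1 = \<dots> = u\<^sub>k\<close> contributes the \<open>k\<close> pairs of consecutive words. The natural-number
  subtractions do not truncate for \<open>m = (n - 1) div 2\<close>, as then \<open>2 * i < n\<close> for all \<open>i \<le> m\<close>.\<close>

definition R1 :: "nat \<Rightarrow> (letter list \<times> letter list) set" where
  "R1 n = {([E i, E i], [E i]) | i. 1 \<le> i \<and> i \<le> n}"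

definition R2 :: "nat \<Rightarrow> (letter list \<times> letter list) set" where
  "R2 n = {([X, Y], [E n]), ([Y, X], [E 1])}"

definition R3 :: "(letter list \<times> letter list) set" where
  "R3 = {([X, E 1], [X]), ([E 1, Y], [Y])}"

definition R4 :: "nat \<Rightarrow> (letter list \<times> letter list) set" where
  "R4 n = {([E i, E j], [E j, E i]) | i j. 1 \<le> i \<and> i < j \<and> j \<le> n}"

definition R5 :: "nat \<Rightarrow> (letter list \<times> letter list) set" where
  "R5 n = {([E i, X], [X, E (i + 1)]) | i. 1 \<le> i \<and> i \<le> n - 1}"

definition R6 :: "nat \<Rightarrow> nat \<Rightarrow> (letter list \<times> letter list) set" where
  "R6 n m =
     {([Xi i, Yi i], es 2 i @ es (i + 2) n) | i. 1 \<le> i \<and> i \<le> m} \<union>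
     {([Yi i, Xi i], es 2 (n - i) @ es (n - i + 2) n) | i. 1 \<le> i \<and> i \<le> m}"

definition R7 :: "nat \<Rightarrow> nat \<Rightarrow> (letter list \<times> letter list) set" where
  "R7 n m =
     {([Xi i, E j], [Xi i]) | i j. 1 \<le> i \<and> i \<le> m \<and> 2 \<le> j \<and> j \<le> n \<and> j \<noteq> n - i + 1} \<union>
     {([E j, Yi i], [Yi i]) | i j. 1 \<le> i \<and> i \<le> m \<and> 2 \<le> j \<and> j \<le> n \<and> j \<noteq> n - i + 1}"

definition R8 :: "nat \<Rightarrow> nat \<Rightarrow> (letter list \<times> letter list) set" where
  "R8 n m =
     {([E j, Xi i], [Xi i]) | i j. 1 \<le> i \<and> i \<le> m \<and> 2 \<le> j \<and> j \<le> n \<and> j \<noteq> i + 1} \<union>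
     {([Yi i, E j], [Yi i]) | i j. 1 \<le> i \<and> i \<le> m \<and> 2 \<le> j \<and> j \<le> n \<and> j \<noteq> i + 1}"

definition R9 :: "nat \<Rightarrow> nat \<Rightarrow> (letter list \<times> letter list) set" where
  "R9 n m =
     {([E 1, Xi i], [Xi i, E 1]) | i. 1 \<le> i \<and> i \<le> m} \<union>
     {([Xi i, E 1],
       replicate (n - 2 * i) X @ es (n - 2 * i + 1) (n - i) @ es (n - i + 2) n)
       | i. 1 \<le> i \<and> i \<le> m} \<union>
     {([E 1, Yi i], [Yi i, E 1]) | i. 1 \<le> i \<and> i \<le> m} \<union>
     {([Yi i, E 1],
       replicate (n - 2 * i) Y @ es 1 i @ es (i + 2) (2 * i))
       | i. 1 \<le> i \<and> i \<le> m}"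

definition R10 :: "nat \<Rightarrow> nat \<Rightarrow> (letter list \<times> letter list) set" where
  "R10 n m =
     {([Xi i, E (n - i + 1)], [E (i + 1), Xi i]) | i. 1 \<le> i \<and> i \<le> m} \<union>
     {([E (i + 1), Xi i], [Yi i, E (i + 1)]) | i. 1 \<le> i \<and> i \<le> m} \<union>
     {([Yi i, E (i + 1)], [E (n - i + 1), Yi i]) | i. 1 \<le> i \<and> i \<le> m} \<union>
     {([E (n - i + 1), Yi i], es 2 n) | i. 1 \<le> i \<and> i \<le> m}"

definition R11 :: "nat \<Rightarrow> (letter list \<times> letter list) set" where
  "R11 n = {(X # es 2 n, es 1 n)}"

definition relations :: "nat \<Rightarrow> nat \<Rightarrow> (letter list \<times> letter list) set" where
  "relations n m =
     R1 n \<union> R2 n \<union> R3 \<union> R4 n \<union> R5 n \<union> R6 n m \<union> R7 n m \<union> R8 n m \<union> R9 n m \<union> R10 n m \<union> R11 n"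

end

theory Submission
  imports Defs
begin

text \<open>
  A nonempty element of \<open>ODI n\<close> is either a restricted translation, or a map
  \<open>p + 1 \<mapsto> q + 1, p + i + 1 \<mapsto> q + n - i + 1\<close> of rank two with \<open>2i \<noteq> n\<close>, which comes from a
  reflection. So every element is represented by a word of the form \<open>\<epsilon>\<^sub>D x\<^sup>k\<close>, \<open>\<epsilon>\<^sub>D y\<^sup>k\<close> or
  \<open>y\<^sup>p c\<^sub>i x\<^sup>q\<close>, where \<open>\<epsilon>\<^sub>D\<close> is the product of the \<open>e\<^sub>j\<close> with \<open>j \<notin> D\<close>, and \<open>c\<^sub>i\<close> is \<open>x\<^sub>i\<close> if
  \<open>2i < n\<close> and \<open>y\<^bsub>n-i\<^esub>\<close> if \<open>2i > n\<close>. The relations imply that, modulo the congruence, the set of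
  these words is closed under right multiplication by letters, and that two of them which evaluate
  to the same map are congruent. Hence evaluation of words has exactly the generated congruence as
  its kernel.
\<close>

section \<open>Normal forms in a model of the relations\<close>

text \<open>The presented monoid lives on a carrier of classes of words, where each calculation
  would drag membership conditions along. Values are therefore taken in an arbitrary type-class
  monoid satisfying the relations; one faithful instance suffices to return to the congruence. The
  bound two on the rank comes from arithmetic modulo n. For points a < b of an order-preserving
  restriction of a reflection, the sum of point and image grows by exactly n from a to b, so a third
  point would force 2n = n. If b - a = i, the images differ by n - i; for 2i = n the map is thus
  already a translation, whence the exclusion. A nonempty restricted translation determines its
  shift, the empty map does not. Its many normal forms have to be identified separately, and
  \<open>R11\<close> enters for this purpose.\<close>

definition val :: "(letter \<Rightarrow> 'a::monoid_mult) \<Rightarrow> letter list \<Rightarrow> 'a" where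
  "val v w = prod_list (map v w)"

lemma val_simps [simp]:
  "val v [] = 1" "val v (a # w) = v a * val v w" "val v (u @ w) = val v u * val v w"
  "val v (replicate k a) = v a ^ k"
  by (induction k) (simp_all add: val_def)

text \<open>With \<open>c\<^sub>i\<close> for \<open>core n i\<close>, the relations for the \<open>x\<^sub>i\<close> and those for the \<open>y\<^sub>i\<close> take the same form;
  \<open>c\<^sub>i\<close> and \<open>c\<^bsub>n-i\<^esub>\<close> are mutually inverse.\<close>

definition core :: "nat \<Rightarrow> nat \<Rightarrow> letter" where
  "core n i = (if 2 * i < n then Xi i else Yi (n - i))"

definition restrict_word :: "nat \<Rightarrow> nat set \<Rightarrow> letter list" where
  "restrict_word n D = map E (sorted_list_of_set ({1..n} - D))"

text \<open>An integer exponent treats powers of x and of y alike. It is not additive: steps in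
  opposite directions do not cancel but leave \<open>e 1\<close> or \<open>e n\<close>
  behind.\<close>

definition shift_word :: "int \<Rightarrow> letter list" where
  "shift_word k = (if k \<ge> 0 then replicate (nat k) X else replicate (nat (- k)) Y)"

definition flip_word :: "nat \<Rightarrow> nat \<Rightarrow> nat \<Rightarrow> nat \<Rightarrow> letter list" where
  "flip_word n p i q = replicate p Y @ [core n i] @ replicate q X"

text \<open>The inequalities place p + 1 < p + i + 1 and q + 1 < n - i + q + 1 in {1..n}; q < i also
  makes i positive.\<close>

definition flip_ok :: "nat \<Rightarrow> nat \<Rightarrow> nat \<Rightarrow> nat \<Rightarrow> bool" where
  "flip_ok n p i q \<longleftrightarrow> p + i < n \<and> q < i \<and> 2 * i \<noteq> n"

definition translation_letters :: "nat \<Rightarrow> letter set" where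
  "translation_letters n = {X, Y} \<union> E ` {1..n}"

lemma set_es [simp]: "set (es a b) = E ` {a..b}"
  unfolding es_def set_map set_upt atLeastLessThanSuc_atLeastAtMost ..

lemma set_restrict_word [simp]: "set (restrict_word n D) = E ` ({1..n} - D)"
  by (simp add: restrict_word_def)

text \<open>Nothing but the relations is assumed of \<open>v\<close>, so an identity derived here is
  a consequence of the relations, yet it can be used for rewriting as an ordinary equation in a
  monoid.\<close>

locale ODI_model =
  fixes n m :: nat and v :: "letter \<Rightarrow> 'a::monoid_mult"
  assumes n: "4 \<le> n" and m: "m = (n - 1) div 2"
    and rel: "(u, w) \<in> relations n m \<Longrightarrow> val v u = val v w"
begin

abbreviation e where "e j \<equiv> v (E j)"
abbreviation x where "x \<equiv> v X"
abbreviation y where "y \<equiv> v Y"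
abbreviation c where "c i \<equiv> v (core n i)"
abbreviation pid where "pid D \<equiv> val v (restrict_word n D)"
abbreviation z where "z k \<equiv> val v (shift_word k)"

section \<open>Commuting idempotents and their passage through shifts\<close>

lemma e_idem: "i \<in> {1..n} \<Longrightarrow> e i * e i = e i"
  using rel[of "[E i, E i]" "[E i]"] by (auto simp: relations_def R1_def)

lemma xy: "x * y = e n" and yx: "y * x = e 1"
  using rel[of "[X, Y]" "[E n]"] rel[of "[Y, X]" "[E 1]"] by (auto simp: relations_def R2_def)

lemma x_e1: "x * e 1 = x" and e1_y: "e 1 * y = y"
  using rel[of "[X, E 1]" "[X]"] rel[of "[E 1, Y]" "[Y]"] by (auto simp: relations_def R3_def)

lemma e_comm: "i \<in> {1..n} \<Longrightarrow> j \<in> {1..n} \<Longrightarrow> e i * e j = e j * e i"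
proof (induction i j rule: linorder_wlog)
  case (le i j)
  then show ?case
    using rel[of "[E i, E j]" "[E j, E i]"]
    by (cases "i = j") (auto simp: relations_def R4_def)
qed simp

lemma e_x: assumes "1 \<le> i" "i < n" shows "e i * x = x * e (i + 1)"
proof -
  have "i \<le> n - 1" using assms by simp
  then show ?thesis using assms rel[of "[E i, X]" "[X, E (i + 1)]"] by (auto simp: relations_def R5_def)
qed

lemma en_x: "e n * x = x"
  by (metis xy yx x_e1 mult.assoc)

lemma y_en: "y * e n = y"
  by (metis xy yx e1_y mult.assoc)

text \<open>\<open>R5\<close> speaks only of x. The version for y results from inserting
  \<open>e n = x * y\<close> after y: y e_i = y e_i e_n = y (e_i x) y, and \<open>R5\<close> applies
  to the bracket.\<close>

lemma y_e: assumes i: "1 \<le> i" "i < n" shows "y * e i = e (i + 1) * y"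
proof -
  have "y * e i = y * e n * e i" by (simp add: y_en)
  also have "\<dots> = y * (e i * x) * y"
    using e_comm[of n i] i by (simp add: mult.assoc xy)
  also have "\<dots> = y * x * e (i + 1) * y" using i by (simp add: e_x mult.assoc)
  also have "\<dots> = e (i + 1) * e 1 * y" using e_comm[of 1 "i + 1"] i by (simp add: yx)
  also have "\<dots> = e (i + 1) * y" using e1_y by (simp add: mult.assoc)
  finally show ?thesis .
qed

lemma val_E_absorb:
  assumes "set xs \<subseteq> {1..n}" "j \<in> set xs"
  shows "val v (map E xs) * e j = val v (map E xs)"
  using assms
proof (induction xs)
  case (Cons a xs)
  show ?case
  proof (cases "j \<in> set xs")
    case True
    then show ?thesis using Cons by (simp add: mult.assoc)
  next
    case False
    have "val v (map E ys) * e a = e a * val v (map E ys)" if "set ys \<subseteq> {1..n}" for ys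
      using that
    proof (induction ys)
      case (Cons b ys)
      then have *: "val v (map E ys) * e a = e a * val v (map E ys)" "e b * e a = e a * e b"
        using \<open>set (a # xs) \<subseteq> {1..n}\<close> by (auto intro: e_comm)
      then show ?case by (simp add: mult.assoc) (metis mult.assoc *)
    qed simp
    then have "val v (map E xs) * e a = e a * val v (map E xs)" using Cons.prems by simp
    then show ?thesis using False Cons.prems e_idem[of a] by (simp add: mult.assoc) (metis mult.assoc)
  qed
qed simp

lemma val_E_comm:
  assumes "set xs \<subseteq> {1..n}" "j \<in> {1..n}"
  shows "val v (map E xs) * e j = e j * val v (map E xs)"
  using assms
proof (induction xs)
  case (Cons a xs)
  then have *: "val v (map E xs) * e j = e j * val v (map E xs)" "e a * e j = e j * e a"
    by (auto intro: e_comm)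
  then show ?case by (simp add: mult.assoc) (metis mult.assoc *)
qed simp

lemma val_E_absorbs:
  assumes "set xs \<subseteq> {1..n}" "set ys \<subseteq> set xs"
  shows "val v (map E xs) * val v (map E ys) = val v (map E xs)"
  using assms(2) by (induction ys) (auto simp: val_E_absorb[OF assms(1)] simp flip: mult.assoc)

lemma val_E_comms:
  assumes "set xs \<subseteq> {1..n}" "set ys \<subseteq> {1..n}"
  shows "val v (map E xs) * val v (map E ys) = val v (map E ys) * val v (map E xs)"
  using assms(2)
proof (induction ys)
  case (Cons a ys)
  then show ?case using val_E_comm[OF assms(1), of a] by simp (metis mult.assoc)
qed simp

text \<open>Each product absorbs the other and the two commute, so both equal their common
  product.\<close>

lemma val_E_cong:
  assumes "set xs \<subseteq> {1..n}" "set ys = set xs"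
  shows "val v (map E xs) = val v (map E ys)"
  using val_E_absorbs[of xs ys] val_E_absorbs[of ys xs] val_E_comms[of xs ys] assms by simp

lemma val_eq_pid: "set w = E ` ({1..n} - D) \<Longrightarrow> val v w = pid D"
proof -
  assume w: "set w = E ` ({1..n} - D)"
  \<comment> \<open>The indices are read off from the letters; the default 0 never occurs, since all
    letters of \<open>w\<close> are of the form \<open>E j\<close>.\<close>
  define xs where "xs = map (\<lambda>a. case a of E j \<Rightarrow> j | _ \<Rightarrow> 0) w"
  have *: "w = map E xs" unfolding xs_def map_map
    by (rule map_idI[symmetric]) (use w in auto)
  have "set xs = {1..n} - D" using w unfolding * by (auto simp: image_iff)
  then show ?thesis unfolding * restrict_word_def by (intro val_E_cong) auto
qed

lemma insert_E_diff: "j \<in> {1..n} \<Longrightarrow> insert (E j) (E ` ({1..n} - D)) = E ` ({1..n} - (D - {j}))"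
  by auto

lemma pid_e: "j \<in> {1..n} \<Longrightarrow> pid D * e j = pid (D - {j})"
  using val_eq_pid[of "restrict_word n D @ [E j]" "D - {j}"] insert_E_diff[of j D] by simp

lemma e_pid: "j \<in> {1..n} \<Longrightarrow> e j * pid D = pid (D - {j})"
  using val_eq_pid[of "E j # restrict_word n D" "D - {j}"] insert_E_diff[of j D] by simp

lemma pid_pid: "pid C * pid D = pid (C \<inter> D)"
  using val_eq_pid[of "restrict_word n C @ restrict_word n D" "C \<inter> D"] by auto

lemma pid_full: "pid {1..n} = 1"
  by (simp add: restrict_word_def)

lemma pid_cong: "C \<inter> {1..n} = D \<inter> {1..n} \<Longrightarrow> pid C = pid D"
  by (rule val_eq_pid) auto

lemma x_pow_e: "j \<in> {1..n} \<Longrightarrow> x ^ k * e j = (if k < j then e (j - k) * x ^ k else x ^ k)"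
proof (induction k arbitrary: j)
  case (Suc k)
  show ?case
  proof (cases "j = 1")
    case True
    then show ?thesis using x_e1 by (simp only: power_Suc2 mult.assoc) simp
  next
    case False
    then have "e (j - 1) * x = x * e j" using e_x[of "j - 1"] Suc.prems by force
    then have "x ^ Suc k * e j = x ^ k * e (j - 1) * x"
      by (simp add: power_Suc2 mult.assoc del: power_Suc)
    also have "\<dots> = (if k < j - 1 then e (j - 1 - k) * x ^ k else x ^ k) * x"
      using Suc.IH[of "j - 1"] Suc.prems False by force
    finally show ?thesis by (auto simp: power_Suc2 mult.assoc simp del: power_Suc)
  qed
qed simp

lemma y_pow_e: "j \<in> {1..n} \<Longrightarrow> y ^ k * e j = (if j + k \<le> n then e (j + k) * y ^ k else y ^ k)"
proof (induction k arbitrary: j)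
  case (Suc k)
  show ?case
  proof (cases "j = n")
    case True
    then show ?thesis using y_en by (simp only: power_Suc2 mult.assoc) simp
  next
    case False
    then have "y ^ Suc k * e j = y ^ k * e (j + 1) * y"
      using y_e[of j] Suc.prems by (simp add: power_Suc2 mult.assoc del: power_Suc)
    also have "\<dots> = (if j + 1 + k \<le> n then e (j + 1 + k) * y ^ k else y ^ k) * y"
      using Suc.IH[of "j + 1"] Suc.prems False by simp
    finally show ?thesis by (auto simp: power_Suc2 mult.assoc simp del: power_Suc)
  qed
qed simp

lemma e_x_pow: "j \<in> {1..n} \<Longrightarrow> n < j + k \<Longrightarrow> e j * x ^ k = x ^ k"
proof (induction k arbitrary: j)
  case (Suc k)
  show ?case
  proof (cases "j = n")
    case True
    then show ?thesis using en_x by (simp flip: mult.assoc)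
  next
    case False
    then have "e j * x ^ Suc k = x * (e (j + 1) * x ^ k)"
      using e_x[of j] Suc.prems by (simp add: mult.assoc flip: mult.assoc)
    then show ?thesis using Suc False by simp
  qed
qed simp

lemma e_y_pow: "j \<in> {1..n} \<Longrightarrow> j \<le> k \<Longrightarrow> e j * y ^ k = y ^ k"
proof (induction k arbitrary: j)
  case (Suc k)
  show ?case
  proof (cases "j = 1")
    case True
    then show ?thesis using e1_y by (simp flip: mult.assoc)
  next
    case False
    then have "y * e (j - 1) = e j * y" using y_e[of "j - 1"] Suc.prems by force
    then have "e j * y ^ Suc k = y * (e (j - 1) * y ^ k)"
      by (simp flip: mult.assoc)
    moreover have "e (j - 1) * y ^ k = y ^ k" by (rule Suc.IH) (use Suc.prems False in auto)
    ultimately show ?thesis by simp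
  qed
qed simp

lemma z_nat: "z (int k) = x ^ k" and z_neg: "z (- int k) = y ^ k"
  by (simp_all add: shift_word_def)

text \<open>The shift reaches j only from j - k. Deleting j from the image is deleting j - k from
  the domain, and changes nothing if j - k lies outside {1..n}.\<close>

lemma z_e:
  assumes "j \<in> {1..n}"
  shows "z k * e j = (if 1 \<le> int j - k \<and> int j - k \<le> int n then e (nat (int j - k)) * z k else z k)"
proof (cases k rule: int_cases2)
  case (nonneg l)
  then show ?thesis using x_pow_e[OF assms, of l] assms by (auto simp: z_nat nat_diff_distrib)
next
  case (nonpos l)
  then show ?thesis using y_pow_e[OF assms, of l] assms by (auto simp: z_neg nat_add_distrib)
qed

lemma e_z:
  assumes "j \<in> {1..n}" "\<not> (1 \<le> int j + k \<and> int j + k \<le> int n)"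
  shows "e j * z k = z k"
proof (cases k rule: int_cases2)
  case (nonneg l)
  then show ?thesis using e_x_pow[OF assms(1), of l] assms by (auto simp: z_nat)
next
  case (nonpos l)
  then show ?thesis using e_y_pow[OF assms(1), of l] assms by (auto simp: z_neg)
qed

text \<open>A point that the shift would move out of {1..n} is not in its domain, so its idempotent
  is absorbed. Hence \<open>z k\<close> is fixed by the idempotent of its own domain.\<close>

lemma pid_z_restrict:
  "pid D * z k = pid (D \<inter> {d. 1 \<le> int d + k \<and> int d + k \<le> int n}) * z k"
proof -
  have *: "val v (map E xs) * z k = z k"
    if "set xs \<subseteq> {d\<in>{1..n}. \<not> (1 \<le> int d + k \<and> int d + k \<le> int n)}" for xs
    using that by (induction xs) (auto simp: mult.assoc intro: e_z)
  let ?C = "{d. 1 \<le> int d + k \<and> int d + k \<le> int n}"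
  have "pid (D \<inter> ?C) * z k = pid D * (pid ?C * z k)"
    by (simp add: pid_pid flip: mult.assoc)
  also have "pid ?C * z k = z k" unfolding restrict_word_def by (rule *) auto
  finally show ?thesis by simp
qed

section \<open>Restricted translations\<close>

definition T where "T = {pid D * z k | D k. D \<subseteq> {1..n}}"

text \<open>The second premise says that j is not in the image of the translation: it has no
  preimage j - k in \<open>D\<close>.\<close>

lemma T_absorb:
  assumes "j \<in> {1..n}" "\<not> (1 \<le> int j - k \<and> nat (int j - k) \<in> D)" "D \<subseteq> {1..n}"
  shows "pid D * z k * e j = pid D * z k"
proof (cases "1 \<le> int j - k \<and> int j - k \<le> int n")
  case True
  then have "pid D * z k * e j = pid D * e (nat (int j - k)) * z k"
    using z_e[OF assms(1), of k] by (simp add: mult.assoc)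
  also have "pid D * e (nat (int j - k)) = pid D"
    using assms True by (subst pid_e) auto
  finally show ?thesis .
next
  case False
  then show ?thesis using z_e[OF assms(1), of k] by (auto simp add: mult.assoc)
qed

lemma T_e: assumes "t \<in> T" "j \<in> {1..n}" shows "t * e j \<in> T"
proof -
  obtain D k where t: "t = pid D * z k" "D \<subseteq> {1..n}" using assms by (auto simp: T_def)
  show ?thesis
  proof (cases "1 \<le> int j - k \<and> int j - k \<le> int n")
    case True
    then have "nat (int j - k) \<in> {1..n}" by (simp add: nat_le_iff) linarith
    then have "t * e j = pid (D - {nat (int j - k)}) * z k"
      using z_e[OF assms(2), of k] t True by (simp add: mult.assoc flip: pid_e)
    then show ?thesis using t by (auto simp: T_def)
  next
    case False
    then show ?thesis using z_e[OF assms(2), of k] t by (auto simp: mult.assoc T_def)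
  qed
qed

text \<open>A letter in the direction of the shift lengthens it. A letter against it undoes one step
  at the price of an idempotent, by y x = e_1 and x y = e_n.\<close>

lemma T_xy: assumes "t \<in> T" shows "t * x \<in> T" "t * y \<in> T"
proof -
  obtain D k where t: "t = pid D * z k" "D \<subseteq> {1..n}" using assms by (auto simp: T_def)
  then have *: "pid D * z l \<in> T" for l by (auto simp: T_def)
  show "t * x \<in> T"
  proof (cases k rule: int_cases)
    case (nonneg l)
    then have "t * x = pid D * z (int (Suc l))"
      by (simp only: t z_nat power_Suc2 mult.assoc)
    then show ?thesis using * by simp
  next
    case (neg l)
    then have "t * x = pid D * z (- int l) * e 1"
      by (simp only: t z_neg power_Suc2 mult.assoc yx)
    then show ?thesis using T_e[OF *[of "- int l"], of 1] n by simp
  qed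
  show "t * y \<in> T"
  proof (cases "- k" rule: int_cases)
    case (nonneg l)
    then have "k = - int l" by simp
    then have "t * y = pid D * z (- int (Suc l))"
      by (simp only: t z_neg power_Suc2 mult.assoc)
    then show ?thesis using * by simp
  next
    case (neg l)
    then have "k = int (Suc l)" by simp
    then have "t * y = pid D * z (int l) * e n"
      by (simp only: t z_nat power_Suc2 mult.assoc xy)
    then show ?thesis using T_e[OF *[of "int l"], of n] n by simp
  qed
qed

lemma T_word: "t \<in> T \<Longrightarrow> set w \<subseteq> translation_letters n \<Longrightarrow> t * val v w \<in> T"
proof (induction w arbitrary: t)
  case (Cons a w)
  then have "t * v a \<in> T" by (auto simp: translation_letters_def T_e T_xy)
  then show ?case using Cons by (simp flip: mult.assoc)
qed simp

lemma z_in_T: "z k \<in> T"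
proof -
  have "pid {1..n} * z k \<in> T" unfolding T_def by blast
  then show ?thesis by (simp only: pid_full mult_1_left)
qed

section \<open>The empty map as a zero for translations\<close>

lemma zero_e: "j \<in> {1..n} \<Longrightarrow> pid {} * e j = pid {}" "j \<in> {1..n} \<Longrightarrow> e j * pid {} = pid {}"
  by (simp_all add: pid_e e_pid)

lemma x_zero: "x * pid {1} = pid {}"
proof -
  have "x * val v (es 2 n) = val v (es 1 n)"
    using rel[of "X # es 2 n" "es 1 n"] by (auto simp: relations_def R11_def)
  moreover have "val v (es 2 n) = pid {1}" by (rule val_eq_pid) auto
  moreover have "val v (es 1 n) = pid {}" by (rule val_eq_pid) auto
  ultimately show ?thesis by simp
qed

lemma val_E_x: "set xs \<subseteq> {1..<n} \<Longrightarrow> val v (map E xs) * x = x * val v (map (\<lambda>j. E (j + 1)) xs)"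
proof (induction xs)
  case (Cons a xs)
  then have "val v (map E (a # xs)) * x = e a * x * val v (map (\<lambda>j. E (j + 1)) xs)"
    by (simp add: mult.assoc)
  also have "\<dots> = x * val v (map (\<lambda>j. E (j + 1)) (a # xs))"
    using e_x[of a] Cons.prems by (simp add: mult.assoc)
  finally show ?case .
qed simp

text \<open>Split off \<open>e n\<close>, which x absorbs. The remaining e_1 ... e_(n-1) passes
  through x and turns into e_2 ... e_n, which is the situation of \<open>R11\<close>.\<close>

lemma zero_x: "pid {} * x = pid {}"
proof -
  have "pid {} * x = pid {n} * (e n * x)" by (simp add: pid_e flip: mult.assoc) (use n in \<open>simp add: pid_e\<close>)
  also have "\<dots> = val v (map E [1..<n]) * x"
    unfolding en_x by (subst val_eq_pid[of "map E [1..<n]" "{n}"]) auto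
  also have "\<dots> = x * val v (map (\<lambda>j. E (j + 1)) [1..<n])"
    by (rule val_E_x) auto
  also have "val v (map (\<lambda>j. E (j + 1)) [1..<n]) = pid {1}"
  proof (rule val_eq_pid)
    have "Suc ` {1..<n} = {1..n} - {1}" by (auto simp: image_Suc_atLeastLessThan)
    then have "E ` Suc ` {1..<n} = E ` ({1..n} - {1})" by (rule arg_cong)
    then show "set (map (\<lambda>j. E (j + 1)) [1..<n]) = E ` ({1..n} - {1})"
      by (simp only: image_image set_map set_upt Suc_eq_plus1)
  qed
  finally show ?thesis using x_zero by simp
qed

lemma zero_y: "pid {} * y = pid {}"
proof -
  have "pid {} * y = pid {} * (x * y)" by (simp add: zero_x flip: mult.assoc)
  then show ?thesis using zero_e[of n] n by (simp add: xy)
qed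

lemma zero_z: "pid {} * z k = pid {}"
proof (cases k rule: int_cases2)
  case (nonneg l)
  have "pid {} * x ^ l = pid {}" by (induction l) (simp_all add: zero_x flip: mult.assoc)
  then show ?thesis using nonneg by (simp add: z_nat)
next
  case (nonpos l)
  have "pid {} * y ^ l = pid {}" by (induction l) (simp_all add: zero_y flip: mult.assoc)
  then show ?thesis using nonpos by (simp add: z_neg)
qed


section \<open>Relations for the rank two generators in uniform notation\<close>

lemma core_cases:
  assumes "1 \<le> i" "i < n" "2 * i \<noteq> n"
  obtains (Xi) "1 \<le> i" "i \<le> m" "2 * i < n" "core n i = Xi i" "core n (n - i) = Yi i"
  | (Yi) l where "1 \<le> l" "l \<le> m" "2 * l < n" "i = n - l" "n - i = l" "core n i = Yi l" "core n (n - i) = Xi l"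
proof (cases "2 * i < n")
  case True
  then show ?thesis using assms m by (intro Xi) (auto simp: core_def)
next
  case False
  then show ?thesis using assms m by (intro Yi[of "n - i"]) (auto simp: core_def)
qed

lemma c_c:
  assumes "1 \<le> i" "i < n" "2 * i \<noteq> n"
  shows "c i * c (n - i) = pid {1, i + 1}"
proof -
  have pid: "val v (es 2 i @ es (i + 2) n) = pid {1, i + 1}"
  proof (rule val_eq_pid)
    have "{2..i} \<union> {i + 2..n} = {1..n} - {1, i + 1}" using assms by auto
    then show "set (es 2 i @ es (i + 2) n) = E ` ({1..n} - {1, i + 1})"
      by (simp flip: image_Un)
  qed
  show ?thesis
    using assms
  proof (cases rule: core_cases)
    case Xi
    then have "([Xi i, Yi i], es 2 i @ es (i + 2) n) \<in> R6 n m"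
      unfolding R6_def by blast
    then have "c i * c (n - i) = val v (es 2 i @ es (i + 2) n)"
      using Xi rel[of "[Xi i, Yi i]" "es 2 i @ es (i + 2) n"] by (simp add: relations_def)
    then show ?thesis using pid by simp
  next
    case (Yi l)
    then have "([Yi l, Xi l], es 2 (n - l) @ es (n - l + 2) n) \<in> R6 n m"
      unfolding R6_def by blast
    then have "c i * c (n - i) = val v (es 2 i @ es (i + 2) n)"
      using Yi rel[of "[Yi l, Xi l]" "es 2 i @ es (i + 2) n"] by (simp add: relations_def)
    then show ?thesis using pid by simp
  qed
qed

lemma c_e_absorb:
  assumes "1 \<le> i" "i < n" "2 * i \<noteq> n" "j \<in> {2..n}" "j \<noteq> n - i + 1"
  shows "c i * e j = c i"
  using assms(1-3)
proof (cases rule: core_cases)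
  case Xi
  then have "([Xi i, E j], [Xi i]) \<in> R7 n m"
    unfolding R7_def using assms by auto
  then show ?thesis
    using Xi rel[of "[Xi i, E j]" "[Xi i]"] by (simp add: relations_def)
next
  case (Yi l)
  then have "([Yi l, E j], [Yi l]) \<in> R8 n m"
    unfolding R8_def using assms by auto
  then show ?thesis
    using Yi rel[of "[Yi l, E j]" "[Yi l]"] by (simp add: relations_def)
qed

lemma e_c_absorb:
  assumes "1 \<le> i" "i < n" "2 * i \<noteq> n" "j \<in> {2..n}" "j \<noteq> i + 1"
  shows "e j * c i = c i"
  using assms(1-3)
proof (cases rule: core_cases)
  case Xi
  then have "([E j, Xi i], [Xi i]) \<in> R8 n m"
    unfolding R8_def using assms by auto
  then show ?thesis
    using Xi rel[of "[E j, Xi i]" "[Xi i]"] by (simp add: relations_def)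
next
  case (Yi l)
  then have "([E j, Yi l], [Yi l]) \<in> R7 n m"
    unfolding R7_def using assms by auto
  then show ?thesis
    using Yi rel[of "[E j, Yi l]" "[Yi l]"] by (simp add: relations_def)
qed

text \<open>Without the point 1, the map of \<open>c i\<close> is the single assignment of n - i + 1
  to i + 1, a restricted translation by n - 2i. Closure needs only that some word in x, y and the
  e_j represents it, so the explicit right-hand sides of \<open>R9\<close> are forgotten.\<close>

lemma c_e1:
  assumes "1 \<le> i" "i < n" "2 * i \<noteq> n"
  obtains w where "set w \<subseteq> translation_letters n" "c i * e 1 = val v w" "e 1 * c i = val v w"
  using assms
proof (cases rule: core_cases)
  case Xi
  let ?w = "replicate (n - 2 * i) X @ es (n - 2 * i + 1) (n - i) @ es (n - i + 2) n"
  have "([E 1, Xi i], [Xi i, E 1]) \<in> R9 n m" "([Xi i, E 1], ?w) \<in> R9 n m"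
    unfolding R9_def using Xi by blast+
  then have "e 1 * c i = c i * e 1" "c i * e 1 = val v ?w"
    using Xi rel[of "[E 1, Xi i]" "[Xi i, E 1]"] rel[of "[Xi i, E 1]" ?w] by (simp_all add: relations_def)
  moreover have "set ?w \<subseteq> translation_letters n"
    using Xi by (auto simp: translation_letters_def)
  ultimately show ?thesis using that by metis
next
  case (Yi l)
  let ?w = "replicate (n - 2 * l) Y @ es 1 l @ es (l + 2) (2 * l)"
  have "([E 1, Yi l], [Yi l, E 1]) \<in> R9 n m" "([Yi l, E 1], ?w) \<in> R9 n m"
    unfolding R9_def using Yi by blast+
  then have "e 1 * c i = c i * e 1" "c i * e 1 = val v ?w"
    using Yi rel[of "[E 1, Yi l]" "[Yi l, E 1]"] rel[of "[Yi l, E 1]" ?w] by (simp_all add: relations_def)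
  moreover have "set ?w \<subseteq> translation_letters n"
    using Yi by (auto simp: translation_letters_def)
  ultimately show ?thesis using that by metis
qed

lemma c_e_collapse:
  assumes "1 \<le> i" "i < n" "2 * i \<noteq> n"
  shows "c i * e (n - i + 1) = pid {1}" "e (i + 1) * c i = pid {1}"
proof -
  have *: "val v (es 2 n) = pid {1}" by (rule val_eq_pid) auto
  have R10: "x_l * e (n - l + 1) = pid {1} \<and> e (l + 1) * x_l = pid {1} \<and>
      y_l * e (l + 1) = pid {1} \<and> e (n - l + 1) * y_l = pid {1}"
    if "1 \<le> l" "l \<le> m" "x_l = v (Xi l)" "y_l = v (Yi l)" for l x_l y_l
  proof -
    have "([Xi l, E (n - l + 1)], [E (l + 1), Xi l]) \<in> relations n m"
      "([E (l + 1), Xi l], [Yi l, E (l + 1)]) \<in> relations n m"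
      "([Yi l, E (l + 1)], [E (n - l + 1), Yi l]) \<in> relations n m"
      "([E (n - l + 1), Yi l], es 2 n) \<in> relations n m"
      unfolding relations_def R10_def using that by blast+
    from this[THEN rel] show ?thesis using * that by simp
  qed
  have "c i * e (n - i + 1) = pid {1} \<and> e (i + 1) * c i = pid {1}"
    using assms
  proof (cases rule: core_cases)
    case Xi
    then show ?thesis using R10[of i] by simp
  next
    case (Yi l)
    then show ?thesis using R10[of l] by simp
  qed
  then show "c i * e (n - i + 1) = pid {1}" "e (i + 1) * c i = pid {1}" by auto
qed

section \<open>Closure of the normal forms under right multiplication by letters\<close>

definition F where "F = {val v (flip_word n p i q) | p i q. flip_ok n p i q}"

lemma T_pid: "t \<in> T \<Longrightarrow> t * pid D \<in> T"
  by (erule T_word) (auto simp: translation_letters_def)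

text \<open>If \<open>t\<close> does not hit both points \<open>1\<close> and \<open>i + 1\<close> of the domain of \<open>c\<^sub>i\<close>, it absorbs \<open>e\<^sub>1\<close> or
  \<open>e\<^bsub>i+1\<^esub>\<close>, and either of these turns \<open>c\<^sub>i\<close> into a translation.\<close>

lemma T_c:
  assumes i: "1 \<le> i" "i < n" "2 * i \<noteq> n" and t: "t \<in> T"
  shows "t * c i \<in> T \<union> F"
proof -
  obtain D k where D: "t = pid D * z k" "D \<subseteq> {1..n}" using t by (auto simp: T_def)
  consider (one) "\<not> (1 \<le> 1 - k \<and> nat (1 - k) \<in> D)"
    | (other) "\<not> (1 \<le> int (i + 1) - k \<and> nat (int (i + 1) - k) \<in> D)"
    | (both) "1 \<le> 1 - k" "nat (1 - k) \<in> D" "nat (int (i + 1) - k) \<in> D" by blast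
  then show ?thesis
  proof cases
    case one
    then have "t * e 1 = t"
      unfolding D(1) using D(2) n by (intro T_absorb) auto
    then show ?thesis using c_e1[OF i] T_word[OF t] by (metis UnI1 mult.assoc)
  next
    case other
    then have "t * e (i + 1) = t"
      unfolding D(1) using D(2) i by (intro T_absorb) auto
    then have "t * c i = t * pid {1}"
      by (metis c_e_collapse(2)[OF i] mult.assoc)
    then show ?thesis using T_pid[OF t] by (metis UnI1)
  next
    case both
    \<comment> \<open>Since 1 is in the image of \<open>t\<close>, the shift is not positive, and
      the points sent to 1 and i + 1 are p + 1 and p + i + 1.\<close>
    define p where "p = nat (- k)"
    have k: "k = - int p" using both p_def by simp
    have p: "p + 1 \<in> D" "p + i + 1 \<in> D"
      using both unfolding k by (simp_all add: nat_add_distrib add.commute add.left_commute)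
    \<comment> \<open>All factors of \<open>pid D\<close> disappear: for j \<le> p,
      \<open>e j\<close> is absorbed by \<open>y ^ p\<close>; otherwise it becomes
      \<open>e (j - p)\<close> behind \<open>y ^ p\<close>, with j - p different from 1 and i + 1,
      and is absorbed by \<open>c i\<close>.\<close>
    have absorb: "val v (map E xs) * (y ^ p * c i) = y ^ p * c i"
      if "set xs \<subseteq> {1..n} - {p + 1, p + i + 1}" for xs
      using that
    proof (induction xs)
      case (Cons j xs)
      then have j: "j \<in> {1..n}" "j \<noteq> p + 1" "j \<noteq> p + i + 1" by auto
      have "e j * (y ^ p * c i) = y ^ p * c i"
      proof (cases "j \<le> p")
        case True
        then show ?thesis using e_y_pow[OF j(1), of p] by (metis mult.assoc)
      next
        case False
        then have "j - p \<in> {1..n}" using j by auto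
        then have "y ^ p * e (j - p) = e j * y ^ p" using y_pow_e[of "j - p" p] j False by simp
        then have "e j * (y ^ p * c i) = y ^ p * (e (j - p) * c i)" by (simp flip: mult.assoc)
        also have "e (j - p) * c i = c i" by (rule e_c_absorb) (use i j False in auto)
        finally show ?thesis .
      qed
      moreover have "val v (map E xs) * (y ^ p * c i) = y ^ p * c i" using Cons by simp
      ultimately show ?case by (simp add: mult.assoc)
    qed simp
    have "pid D * (y ^ p * c i) = y ^ p * c i"
      unfolding restrict_word_def by (rule absorb) (use p in auto)
    then have "t * c i = val v (flip_word n p i 0)"
      by (simp add: D k z_neg flip_word_def mult.assoc)
    moreover have "flip_ok n p i 0" using p i D by (auto simp: flip_ok_def)
    ultimately show ?thesis by (auto simp: F_def)
  qed
qed

lemma flip_val: "val v (flip_word n p i q) = y ^ p * c i * x ^ q"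
  by (simp add: flip_word_def mult.assoc)

lemma y_pow_in_T: "y ^ p \<in> T"
  using z_in_T[of "- int p"] by (simp add: z_neg)

lemma x_pow_T: "t \<in> T \<Longrightarrow> t * x ^ q \<in> T"
  by (induction q) (auto simp: power_Suc2 T_xy simp del: power_Suc simp flip: mult.assoc)

lemma F_e_absorb:
  assumes "flip_ok n p i q" "j \<in> {1..n}" "j \<noteq> q + 1" "j \<noteq> n - i + q + 1"
  shows "val v (flip_word n p i q) * e j = val v (flip_word n p i q)"
proof (cases "q < j")
  case True
  then have "val v (flip_word n p i q) * e j = y ^ p * (c i * e (j - q)) * x ^ q"
    using x_pow_e[OF assms(2), of q] by (simp add: flip_val mult.assoc)
  also have "c i * e (j - q) = c i"
    by (rule c_e_absorb) (use assms True in \<open>auto simp: flip_ok_def\<close>)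
  finally show ?thesis by (simp add: flip_val)
next
  case False
  then show ?thesis using x_pow_e[OF assms(2), of q] by (simp add: flip_val mult.assoc)
qed

text \<open>These j are the two image points. Moved to the left through \<open>x ^ q\<close>, the
  idempotent meets \<open>c i\<close> as \<open>e 1\<close> or \<open>e (n - i + 1)\<close>, and
  either product is a translation.\<close>

lemma F_e_collapse:
  assumes "flip_ok n p i q" "j = q + 1 \<or> j = n - i + q + 1"
  shows "val v (flip_word n p i q) * e j \<in> T"
proof -
  have i: "1 \<le> i" "i < n" "2 * i \<noteq> n" "q < i" and j: "j \<in> {1..n}" "q < j"
    using assms by (auto simp: flip_ok_def)
  have *: "val v (flip_word n p i q) * e j = y ^ p * (c i * e (j - q)) * x ^ q"
    using x_pow_e[OF j(1), of q] j by (simp add: flip_val mult.assoc)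
  from assms(2) show ?thesis
  proof
    assume "j = q + 1"
    then have "j - q = 1" by simp
    then show ?thesis using c_e1[OF i(1-3)] * T_word[OF y_pow_in_T] x_pow_T by metis
  next
    assume "j = n - i + q + 1"
    then have "j - q = n - i + 1" by simp
    then show ?thesis using c_e_collapse(1)[OF i(1-3)] * T_pid[OF y_pow_in_T] x_pow_T by metis
  qed
qed

lemma F_e:
  assumes "s \<in> F" "j \<in> {1..n}"
  shows "s * e j \<in> T \<union> F"
  using assms F_e_absorb F_e_collapse unfolding F_def by fast

lemma F_x:
  assumes "s \<in> F"
  shows "s * x \<in> T \<union> F"
proof -
  obtain p i q where s: "s = val v (flip_word n p i q)" "flip_ok n p i q" using assms by (auto simp: F_def)
  have sx: "s * x = val v (flip_word n p i (q + 1))"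
    by (simp only: s flip_val power_Suc2 mult.assoc Suc_eq_plus1[symmetric])
  show ?thesis
  proof (cases "q + 1 < i")
    case True
    then have "flip_ok n p i (q + 1)" using s by (simp add: flip_ok_def)
    then show ?thesis using sx by (auto simp: F_def)
  next
    case False
    then have q: "q + 1 = i" using s by (simp add: flip_ok_def)
    have i: "1 \<le> i" "i < n" "2 * i \<noteq> n" using s by (auto simp: flip_ok_def)
    \<comment> \<open>The larger image point is n and x pushes it out. Algebraically,
      \<open>x ^ i\<close> provides the idempotent that collapses \<open>c i\<close>.\<close>
    have "e (n - i + 1) * x ^ i = x ^ i" by (rule e_x_pow) (use i in auto)
    then have "s * x = y ^ p * (c i * e (n - i + 1)) * x ^ i"
      unfolding sx q flip_val by (simp only: mult.assoc)
    then show ?thesis using c_e_collapse(1)[OF i] T_pid[OF y_pow_in_T] x_pow_T by auto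
  qed
qed

lemma F_y:
  assumes "s \<in> F"
  shows "s * y \<in> T \<union> F"
proof -
  obtain p i q where s: "s = val v (flip_word n p i q)" "flip_ok n p i q" using assms by (auto simp: F_def)
  show ?thesis
  proof (cases q)
    case 0
    \<comment> \<open>The smaller image point is 1, which lies outside the domain of y.\<close>
    then have "s * y = s * e 1 * y" by (simp only: e1_y mult.assoc)
    then show ?thesis using F_e_collapse[OF s(2), of 1] s 0 T_xy(2) by auto
  next
    case (Suc r)
    have "s * y = val v (flip_word n p i r) * e n"
      unfolding s flip_val Suc power_Suc2 mult.assoc xy ..
    moreover have "val v (flip_word n p i r) \<in> F" using s Suc unfolding F_def flip_ok_def by force
    ultimately show ?thesis using F_e[of _ n] n by auto
  qed
qed

text \<open>The image of \<open>s\<close> equals the domain {1, l + 1} of \<open>c l\<close> only if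
  q = 0 and l = n - i, when two mutually inverse factors meet. Otherwise some image point j is
  outside this domain; \<open>c l\<close> absorbs \<open>e j\<close>, which first turns
  \<open>s\<close> into a translation.\<close>

lemma F_c:
  assumes "s \<in> F" and l: "1 \<le> l" "l < n" "2 * l \<noteq> n"
  shows "s * c l \<in> T \<union> F"
proof -
  obtain p i q where s: "s = val v (flip_word n p i q)" "flip_ok n p i q" using assms by (auto simp: F_def)
  show ?thesis
  proof (cases "q = 0 \<and> l = n - i")
    case True
    have "s * c l = y ^ p * pid {1, i + 1}"
      using c_c[of i] s True by (auto simp: flip_val flip_ok_def mult.assoc)
    then show ?thesis using T_pid[OF y_pow_in_T] by auto
  next
    case False
    obtain j where j: "j = q + 1 \<or> j = n - i + q + 1" "j \<noteq> 1" "j \<noteq> l + 1"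
    proof (cases "q + 1 \<notin> {1, l + 1}")
      case False' : False
      have "n - i + q + 1 \<notin> {1, l + 1}" using s False False' by (auto simp: flip_ok_def)
      then show ?thesis using that by blast
    qed (use that in blast)
    then have "s * c l = s * e j * c l"
      using e_c_absorb[OF l, of j] s by (auto simp: flip_ok_def mult.assoc)
    then show ?thesis using T_c[OF l F_e_collapse[OF s(2) j(1)]] s by simp
  qed
qed

lemma val_in_TF:
  assumes "w \<in> lists (alphabet n m)"
  shows "val v w \<in> T \<union> F"
proof -
  have letter: "s * v a \<in> T \<union> F" if s: "s \<in> T \<union> F" and a: "a \<in> alphabet n m" for s a
  proof -
    consider "a = X" | "a = Y" | j where "j \<in> {1..n}" "a = E j"
      | i where "i \<in> {1..m}" "a = Xi i" | i where "i \<in> {1..m}" "a = Yi i"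
      using a by (auto simp: alphabet_def)
    then show ?thesis
    proof cases
      case (4 i)
      then have "1 \<le> i" "i < n" "2 * i \<noteq> n" "a = core n i" using m n by (auto simp: core_def)
      then show ?thesis using s T_c F_c by blast
    next
      case (5 i)
      then have "1 \<le> n - i" "n - i < n" "2 * (n - i) \<noteq> n" "a = core n (n - i)"
        using m n by (auto simp: core_def)
      then show ?thesis using s T_c F_c by blast
    qed (use s T_e T_xy F_e F_x F_y in blast)+
  qed
  have "s * val v w \<in> T \<union> F" if "s \<in> T \<union> F" for s
    using assms that
  proof (induction w arbitrary: s)
    case (Cons a w)
    then show ?case using letter by (simp flip: mult.assoc)
  qed simp
  moreover have "1 \<in> T" using z_in_T[of 0] z_nat[of 0] by simp
  ultimately show ?thesis by (metis UnI1 mult_1_left)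
qed

end

section \<open>Presentations\<close>

lemma free_monoid_simps [simp]:
  "carrier (free_monoid A) = lists A" "u \<otimes>\<^bsub>free_monoid A\<^esub> w = u @ w" "\<one>\<^bsub>free_monoid A\<^esub> = []"
  by (simp_all add: free_monoid_def)

lemma generated_congruence_subset: "R \<subseteq> generated_congruence M R"
  by (auto simp: generated_congruence_def)

lemma generated_congruence_least:
  "monoid_congruence M r \<Longrightarrow> R \<subseteq> r \<Longrightarrow> generated_congruence M R \<subseteq> r"
  by (auto simp: generated_congruence_def)

lemma monoid_congruence_generated:
  assumes R: "R \<subseteq> lists A \<times> lists A"
  shows "monoid_congruence (free_monoid A) (generated_congruence (free_monoid A) R)"
proof -
  define C where "C = {r. monoid_congruence (free_monoid A) r \<and> R \<subseteq> r}"
  \<comment> \<open>The family is nonempty, so the intersection stays inside the carrier; an empty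
    family would give the universal relation on the whole type.\<close>
  have "lists A \<times> lists A \<in> C"
    using R by (auto simp: C_def monoid_congruence_def equiv_def refl_on_def sym_def trans_def)
  then have "\<Inter>C \<subseteq> lists A \<times> lists A" by blast
  moreover have C: "equiv (lists A) r" "(a, b) \<in> r \<Longrightarrow> (c, d) \<in> r \<Longrightarrow> (a @ c, b @ d) \<in> r"
    if "r \<in> C" for r a b c d
    using that by (simp_all add: C_def monoid_congruence_def)
  moreover have "refl_on (lists A) (\<Inter>C)"
    using C(1) by (auto simp: refl_on_def equiv_def)
  moreover have "sym (\<Inter>C)"
    using C(1) unfolding sym_def equiv_def by blast
  moreover have "trans (\<Inter>C)"
    using C(1) unfolding trans_def equiv_def by blast
  ultimately have "monoid_congruence (free_monoid A) (\<Inter>C)"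
    by (auto simp: monoid_congruence_def equiv_def)
  then show ?thesis by (simp only: generated_congruence_def C_def)
qed

text \<open>Homomorphism theorem for monoids. By \<open>ker\<close>, the classes are the fibres of
  \<open>\<phi>\<close>; sending an element to its fibre gives the isomorphism in the required
  direction without choosing representatives.\<close>

lemma defined_by_presentationI:
  fixes M (structure)
  assumes M: "monoid M" and R: "R \<subseteq> lists A \<times> lists A"
    and mult: "\<And>u w. u \<in> lists A \<Longrightarrow> w \<in> lists A \<Longrightarrow> \<phi> (u @ w) = \<phi> u \<otimes> \<phi> w"
    and surj: "\<phi> ` lists A = carrier M"
    and ker: "\<And>u w. u \<in> lists A \<Longrightarrow> w \<in> lists A \<Longrightarrow>
      \<phi> u = \<phi> w \<longleftrightarrow> (u, w) \<in> generated_congruence (free_monoid A) R"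
  shows "defined_by_presentation M A R"
proof -
  define r where "r = generated_congruence (free_monoid A) R"
  have r: "equiv (lists A) r"
    using monoid_congruence_generated[OF R] by (simp add: monoid_congruence_def r_def)
  have ker: "r `` {u} = {w \<in> lists A. \<phi> w = \<phi> u}" if "u \<in> lists A" for u
  proof -
    have *: "w \<in> lists A" if "(u, w) \<in> r" for w using that equiv_type[OF r] by auto
    show ?thesis
    proof (intro equalityI subsetI)
      fix w assume "w \<in> r `` {u}"
      then show "w \<in> {w \<in> lists A. \<phi> w = \<phi> u}" using *[of w] ker[OF that, of w] by (simp add: r_def)
    next
      fix w assume "w \<in> {w \<in> lists A. \<phi> w = \<phi> u}"
      then show "w \<in> r `` {u}" using ker[OF that, of w] by (simp add: r_def)
    qed
  qed
  define h where "h \<alpha> = {w \<in> lists A. \<phi> w = \<alpha>}" for \<alpha>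
  have h: "h (\<phi> u) = r `` {u}" if "u \<in> lists A" for u
    using ker that by (simp add: h_def)
  let ?Q = "quotient_monoid (free_monoid A) r"
  have "h \<in> iso M ?Q"
  proof (rule isoI)
    show "bij_betw h (carrier M) (carrier ?Q)"
      unfolding bij_betw_def
    proof
      show "inj_on h (carrier M)"
        unfolding surj[symmetric] by (rule inj_onI) (auto simp: h_def)
      show "h ` carrier M = carrier ?Q"
        unfolding surj[symmetric]
        by (simp add: quotient_monoid_def quotient_def image_image h cong: image_cong_simp) blast
    qed
    show "h \<in> hom M ?Q"
    proof (rule homI)
      show "h \<alpha> \<in> carrier ?Q" if "\<alpha> \<in> carrier M" for \<alpha>
      proof -
        from that obtain u where "u \<in> lists A" "\<alpha> = \<phi> u" unfolding surj[symmetric] by blast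
        then show ?thesis using h[of u] by (simp add: quotient_monoid_def quotientI)
      qed
      fix \<alpha> \<beta> assume "\<alpha> \<in> carrier M" "\<beta> \<in> carrier M"
      then obtain u w where uw: "u \<in> lists A" "w \<in> lists A" "\<alpha> = \<phi> u" "\<beta> = \<phi> w"
        unfolding surj[symmetric] by blast
      have class_eq: "r `` {a @ b} = r `` {u @ w}" if "a \<in> h \<alpha>" "b \<in> h \<beta>" for a b
        using that uw mult by (subst (1 2) ker) (auto simp: h_def)
      have "u \<in> h \<alpha>" "w \<in> h \<beta>" using uw by (auto simp: h_def)
      have "h \<alpha> \<otimes>\<^bsub>?Q\<^esub> h \<beta> = (\<Union>a\<in>h \<alpha>. \<Union>b\<in>h \<beta>. r `` {a @ b})"
        by (simp add: quotient_monoid_def)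
      also have "\<dots> = (\<Union>a\<in>h \<alpha>. \<Union>b\<in>h \<beta>. r `` {u @ w})"
        by (intro SUP_cong refl) (rule class_eq)
      also have "\<dots> = r `` {u @ w}"
        using \<open>u \<in> h \<alpha>\<close> \<open>w \<in> h \<beta>\<close> by blast
      also have "\<dots> = h (\<alpha> \<otimes> \<beta>)" using uw mult h[of "u @ w"] by auto
      finally show "h (\<alpha> \<otimes> \<beta>) = h \<alpha> \<otimes>\<^bsub>?Q\<^esub> h \<beta>" ..
    qed
  qed
  then show ?thesis
    using M R unfolding defined_by_presentation_def is_iso_def r_def by blast
qed

section \<open>A faithful model of the presented monoid\<close>

text \<open>Words act on the classes by right multiplication; \<open>s * t\<close> means first \<open>s\<close>, then \<open>t\<close>.\<close>

datatype 'a endo = Endo (app: "'a \<Rightarrow> 'a")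

instantiation endo :: (type) monoid_mult
begin

definition "1 = Endo (\<lambda>a. a)"
definition "s * t = Endo (\<lambda>a. app t (app s a))"

instance by standard (simp_all add: one_endo_def times_endo_def)

end

lemma app_simps [simp]: "app 1 a = a" "app (s * t) a = app t (app s a)"
  by (simp_all add: one_endo_def times_endo_def)

lemma endo_eqI: "(\<And>a. app s a = app t a) \<Longrightarrow> s = t"
  by (cases s; cases t) (auto simp: fun_eq_iff)

text \<open>Functions of type \<open>endo\<close> are total. Off the classes they are the identity
  here, so all words act alike there and only the classes decide equality.\<close>

definition right_mult :: "'a set \<Rightarrow> ('a list \<times> 'a list) set \<Rightarrow> 'a \<Rightarrow> 'a list set endo" where
  "right_mult A r a = Endo (\<lambda>U. if U \<in> lists A // r then \<Union>u\<in>U. r `` {u @ [a]} else U)"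

text \<open>This is the regular representation: it is faithful because \<open>u\<close> takes the
  class of the empty word to the class of \<open>u\<close>.\<close>

lemma val_right_mult_eq_iff:
  assumes r: "monoid_congruence (free_monoid A) r" and u: "u \<in> lists A" and w: "w \<in> lists A"
  shows "val (right_mult A r) u = val (right_mult A r) w \<longleftrightarrow> (u, w) \<in> r"
proof -
  have eq: "equiv (lists A) r" and
    cong: "\<And>a b c d. (a, b) \<in> r \<Longrightarrow> (c, d) \<in> r \<Longrightarrow> (a @ c, b @ d) \<in> r"
    using r by (auto simp: monoid_congruence_def)
  have refl: "(s, s) \<in> r" if "s \<in> lists A" for s
    using eq that by (auto simp: equiv_def refl_on_def)
  have letter: "app (right_mult A r a) (r `` {s}) = r `` {s @ [a]}"
    if "s \<in> lists A" "a \<in> A" for s a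
  proof -
    have "r `` {t @ [a]} = r `` {s @ [a]}" if "t \<in> r `` {s}" for t
    proof -
      have "(s @ [a], t @ [a]) \<in> r" using that \<open>a \<in> A\<close> by (simp add: cong refl)
      then show ?thesis using equiv_class_eq[OF eq] by simp
    qed
    moreover have "s \<in> r `` {s}" using refl that by auto
    ultimately have "(\<Union>t\<in>r `` {s}. r `` {t @ [a]}) = r `` {s @ [a]}" by blast
    then show ?thesis using that(1) by (simp add: right_mult_def quotientI)
  qed
  have word: "app (val (right_mult A r) t) (r `` {s}) = r `` {s @ t}"
    if "s \<in> lists A" "t \<in> lists A" for s t
    using that by (induction t arbitrary: s) (auto simp: letter)
  have other: "app (val (right_mult A r) t) U = U" if "U \<notin> lists A // r" for t U
    using that by (induction t) (auto simp: right_mult_def)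
  show ?thesis
  proof
    assume "val (right_mult A r) u = val (right_mult A r) w"
    then have "r `` {u} = r `` {w}" using word[of "[]" u] word[of "[]" w] u w by simp
    then show "(u, w) \<in> r" using eq_equiv_class_iff[OF eq u w] by simp
  next
    assume uw: "(u, w) \<in> r"
    show "val (right_mult A r) u = val (right_mult A r) w"
    proof (rule endo_eqI)
      fix U
      show "app (val (right_mult A r) u) U = app (val (right_mult A r) w) U"
      proof (cases "U \<in> lists A // r")
        case True
        then obtain s where s: "s \<in> lists A" "U = r `` {s}" unfolding quotient_def by blast
        then have "(s @ u, s @ w) \<in> r" using uw by (intro cong refl)
        then have "r `` {s @ u} = r `` {s @ w}" by (rule equiv_class_eq[OF eq])
        then show ?thesis using word[OF s(1) u] word[OF s(1) w] by (simp add: s(2))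
      qed (simp add: other)
    qed
  qed
qed

section \<open>Evaluation of words\<close>

fun letter_map :: "nat \<Rightarrow> letter \<Rightarrow> nat \<rightharpoonup> nat" where
  "letter_map n X d = (if 1 \<le> d \<and> d < n then Some (d + 1) else None)"
| "letter_map n Y d = (if 1 < d \<and> d \<le> n then Some (d - 1) else None)"
| "letter_map n (E j) d = (if d \<in> {1..n} - {j} then Some d else None)"
| "letter_map n (Xi i) d =
    (if d = 1 then Some 1 else if d = i + 1 then Some (n - i + 1) else None)"
| "letter_map n (Yi i) d =
    (if d = 1 then Some 1 else if d = n - i + 1 then Some (i + 1) else None)"

fun word_map :: "nat \<Rightarrow> letter list \<Rightarrow> nat \<rightharpoonup> nat" where
  "word_map n [] = Some |` {1..n}"
| "word_map n (a # w) = word_map n w \<circ>\<^sub>m letter_map n a"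

lemma restrict_Some_comp: "dom \<alpha> \<subseteq> S \<Longrightarrow> \<alpha> \<circ>\<^sub>m (Some |` S) = \<alpha>"
proof
  fix d assume "dom \<alpha> \<subseteq> S"
  then have "d \<notin> S \<Longrightarrow> \<alpha> d = None" by auto
  then show "(\<alpha> \<circ>\<^sub>m Some |` S) d = \<alpha> d" by (simp add: map_comp_def restrict_map_def)
qed

lemma dom_letter_map: "a \<in> alphabet n ((n - 1) div 2) \<Longrightarrow> 1 \<le> n \<Longrightarrow> dom (letter_map n a) \<subseteq> {1..n}"
  by (auto simp: alphabet_def split: if_splits)

lemma dom_word_map:
  "w \<in> lists (alphabet n ((n - 1) div 2)) \<Longrightarrow> 1 \<le> n \<Longrightarrow> dom (word_map n w) \<subseteq> {1..n}"
proof (cases w)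
  case (Cons a w')
  assume "w \<in> lists (alphabet n ((n - 1) div 2))" "1 \<le> n"
  with dom_letter_map[of a n] show ?thesis
    by (auto simp: Cons map_comp_def split: option.splits)
qed auto

text \<open>The empty word evaluates to the identity on {1..n} only, which is neutral on the left
  just for maps with domain inside {1..n}; hence the premise.\<close>

lemma word_map_append: "dom (word_map n w) \<subseteq> {1..n} \<Longrightarrow> word_map n (u @ w) = word_map n w \<circ>\<^sub>m word_map n u"
proof (induction u)
  case Nil
  then show ?case using restrict_Some_comp[of "word_map n w" "{1..n}"] by simp
next
  case (Cons a u)
  then show ?case by (auto simp: map_comp_def split: option.splits)
qed

lemma word_map_E: "word_map n (map E xs) d = (if d \<in> {1..n} - set xs then Some d else None)"
  by (induction xs) (auto simp: map_comp_def)

lemma word_map_X: "word_map n (replicate k X) d = (if 1 \<le> d \<and> d + k \<le> n then Some (d + k) else None)"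
  by (induction k arbitrary: d) (auto simp: map_comp_def)

lemma word_map_Y: "word_map n (replicate k Y) d = (if k < d \<and> d \<le> n then Some (d - k) else None)"
  by (induction k arbitrary: d) (auto simp: map_comp_def)

lemma word_map_es: "word_map n (es a b) d = (if d \<in> {1..n} - {a..b} then Some d else None)"
  unfolding es_def word_map_E by (simp only: set_upt atLeastLessThanSuc_atLeastAtMost)

lemma word_map_append_es: "word_map n (u @ es a b) = word_map n (es a b) \<circ>\<^sub>m word_map n u"
  by (rule word_map_append) (auto simp: word_map_es split: if_splits)

lemma word_map_X_es:
  "word_map n (replicate k X @ es a b @ es a' b') d =
    (if 1 \<le> d \<and> d + k \<le> n \<and> d + k \<notin> {a..b} \<union> {a'..b'} then Some (d + k) else None)"
  unfolding append_assoc[symmetric] word_map_append_es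
  by (auto simp: map_comp_def word_map_X word_map_es)

lemma word_map_Y_es:
  "word_map n (replicate k Y @ es a b @ es a' b') d =
    (if k < d \<and> d \<le> n \<and> d - k \<notin> {a..b} \<union> {a'..b'} then Some (d - k) else None)"
  unfolding append_assoc[symmetric] word_map_append_es
  by (auto simp: map_comp_def word_map_Y word_map_es)

lemma in_alphabet_iff [simp]:
  "X \<in> alphabet n m" "Y \<in> alphabet n m" "E j \<in> alphabet n m \<longleftrightarrow> j \<in> {1..n}"
  "Xi i \<in> alphabet n m \<longleftrightarrow> i \<in> {1..m}" "Yi i \<in> alphabet n m \<longleftrightarrow> i \<in> {1..m}"
  by (auto simp: alphabet_def)

lemma relations_lists:
  assumes "4 \<le> n"
  shows "relations n ((n - 1) div 2) \<subseteq> lists (alphabet n ((n - 1) div 2)) \<times> lists (alphabet n ((n - 1) div 2))"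
proof -
  let ?m = "(n - 1) div 2" and ?L = "lists (alphabet n ((n - 1) div 2)) \<times> lists (alphabet n ((n - 1) div 2))"
  have half: "i \<le> (n - Suc 0) div 2 \<longleftrightarrow> 2 * i < n" for i
    using assms by linarith
  have "R1 n \<subseteq> ?L" "R2 n \<subseteq> ?L" "R3 \<subseteq> ?L" "R4 n \<subseteq> ?L" "R11 n \<subseteq> ?L"
    using assms by (auto simp: R1_def R2_def R3_def R4_def R11_def)
  moreover have "R5 n \<subseteq> ?L" "R7 n ?m \<subseteq> ?L" "R8 n ?m \<subseteq> ?L"
    using assms by (auto simp: R5_def R7_def R8_def)
  moreover have "R6 n ?m \<subseteq> ?L" "R9 n ?m \<subseteq> ?L" "R10 n ?m \<subseteq> ?L"
    by (auto simp: R6_def R9_def R10_def half) linarith+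
  ultimately show ?thesis unfolding relations_def by blast
qed

lemma word_map_relations:
  assumes n: "4 \<le> n" and uw: "(u, w) \<in> relations n ((n - 1) div 2)"
  shows "word_map n u = word_map n w"
proof
  fix d
  let ?m = "(n - 1) div 2"
  note simps = map_comp_def word_map_X word_map_Y word_map_es word_map_append_es append_assoc[symmetric]
  consider "(u, w) \<in> R1 n \<union> R2 n \<union> R3 \<union> R4 n \<union> R5 n" | "(u, w) \<in> R6 n ?m"
    | "(u, w) \<in> R7 n ?m \<union> R8 n ?m" | "(u, w) \<in> R9 n ?m" | "(u, w) \<in> R10 n ?m" | "(u, w) \<in> R11 n"
    using uw unfolding relations_def by blast
  then show "word_map n u d = word_map n w d"
  proof cases
    case 1
    then show ?thesis using n
      by (auto simp: R1_def R2_def R3_def R4_def R5_def simps)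
  next
    case 2
    then show ?thesis using n by (auto simp: R6_def simps simp del: append_assoc)
  next
    case 3
    then show ?thesis using n by (auto simp: R7_def R8_def simps simp del: append_assoc)
  next
    case 4
    then obtain i where i: "1 \<le> i" "i \<le> ?m" and
      "(u, w) = ([E 1, Xi i], [Xi i, E 1]) \<or>
      (u, w) = ([Xi i, E 1], replicate (n - 2 * i) X @ es (n - 2 * i + 1) (n - i) @ es (n - i + 2) n) \<or>
      (u, w) = ([E 1, Yi i], [Yi i, E 1]) \<or>
      (u, w) = ([Yi i, E 1], replicate (n - 2 * i) Y @ es 1 i @ es (i + 2) (2 * i))"
      unfolding R9_def by blast
    \<comment> \<open>Writing n as 2i + k with k > 0 removes the truncated subtractions from
      \<open>R9\<close>.\<close>
    moreover obtain k where "n = 2 * i + k" "0 < k" using i by (intro that[of "n - 2 * i"]) auto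
    ultimately show ?thesis
      by (elim disjE) (auto simp: map_comp_def word_map_X_es word_map_Y_es)
  next
    case 5
    then show ?thesis using n by (auto simp: R10_def simps simp del: append_assoc)
  next
    case 6
    then show ?thesis using n by (auto simp: R11_def simps simp del: append_assoc)
  qed
qed

lemma translation_lists: "restrict_word n D @ shift_word k \<in> lists (alphabet n m)"
  by (auto simp: alphabet_def shift_word_def split: if_splits)

lemma word_map_restrict_word: "word_map n (restrict_word n D) d = (if d \<in> {1..n} \<inter> D then Some d else None)"
  by (auto simp: restrict_word_def word_map_E)

lemma word_map_shift_word:
  "word_map n (shift_word k) d =
    (if d \<in> {1..n} \<and> 1 \<le> int d + k \<and> int d + k \<le> int n then Some (nat (int d + k)) else None)"
  by (auto simp: shift_word_def word_map_X word_map_Y nat_add_distrib)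

lemma word_map_translation:
  "word_map n (restrict_word n D @ shift_word k) d =
    (if d \<in> {1..n} \<inter> D \<and> 1 \<le> int d + k \<and> int d + k \<le> int n then Some (nat (int d + k)) else None)"
proof -
  have "dom (word_map n (shift_word k)) \<subseteq> {1..n}" by (auto simp: word_map_shift_word split: if_splits)
  then show ?thesis by (auto simp: word_map_append map_comp_def word_map_restrict_word word_map_shift_word)
qed

lemma flip_word_lists: "flip_ok n p i q \<Longrightarrow> flip_word n p i q \<in> lists (alphabet n ((n - 1) div 2))"
proof -
  assume a: "flip_ok n p i q"
  then have "i \<in> {1..(n - 1) div 2} \<or> n - i \<in> {1..(n - 1) div 2} \<and> \<not> 2 * i < n"
    unfolding flip_ok_def atLeastAtMost_iff by linarith
  then show ?thesis by (auto simp: flip_word_def alphabet_def core_def)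
qed

lemma word_map_flip_word:
  assumes "flip_ok n p i q"
  shows "word_map n (flip_word n p i q) = [p + 1 \<mapsto> q + 1, p + i + 1 \<mapsto> n - i + q + 1]"
proof
  fix d
  have "dom (word_map n (core n i # replicate q X)) \<subseteq> {1..n}"
    using assms by (auto simp: word_map_X core_def flip_ok_def map_comp_def split: if_splits)
  then have "word_map n (flip_word n p i q) = word_map n (core n i # replicate q X) \<circ>\<^sub>m word_map n (replicate p Y)"
    using word_map_append[of n "core n i # replicate q X" "replicate p Y"] by (simp add: flip_word_def)
  then show "word_map n (flip_word n p i q) d = [p + 1 \<mapsto> q + 1, p + i + 1 \<mapsto> n - i + q + 1] d"
    using assms by (auto simp: map_comp_def word_map_X word_map_Y core_def flip_ok_def)
qed

text \<open>A translation preserves distances, whereas the flip takes two points at distance i to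
  points at distance n - i, and 2i \<noteq> n.\<close>

lemma word_map_translation_neq_flip_word:
  assumes "flip_ok n p i q"
  shows "word_map n (restrict_word n D @ shift_word k) \<noteq> word_map n (flip_word n p i q)"
proof
  assume eq: "word_map n (restrict_word n D @ shift_word k) = word_map n (flip_word n p i q)"
  have "word_map n (restrict_word n D @ shift_word k) (p + 1) = Some (q + 1)"
    "word_map n (restrict_word n D @ shift_word k) (p + i + 1) = Some (n - i + q + 1)"
    using assms unfolding eq by (auto simp: word_map_flip_word flip_ok_def)
  then have "nat (int (p + 1) + k) = q + 1" "nat (int (p + i + 1) + k) = n - i + q + 1"
    unfolding word_map_translation by (metis option.distinct(1) option.inject)+
  then show False using assms by (auto simp: flip_ok_def)
qed

lemma flip_word_inj:
  assumes ok: "flip_ok n p i q" "flip_ok n p' i' q'"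
    and eq: "word_map n (flip_word n p i q) = word_map n (flip_word n p' i' q')"
  shows "flip_word n p i q = flip_word n p' i' q'"
proof -
  have *: "[p + 1 \<mapsto> q + 1, p + i + 1 \<mapsto> n - i + q + 1] = [p' + 1 \<mapsto> q' + 1, p' + i' + 1 \<mapsto> n - i' + q' + 1]"
    using eq by (simp only: word_map_flip_word ok)
  have "p = p' \<and> i = i'"
    using arg_cong[OF *, of dom] ok by (auto simp: flip_ok_def doubleton_eq_iff)
  moreover from this have "q = q'"
    using fun_cong[OF *, of "p + 1"] ok by (auto simp: flip_ok_def)
  ultimately show ?thesis by simp
qed

context ODI_model
begin

lemma T_word_form: "s \<in> T \<Longrightarrow> \<exists>D k. D \<subseteq> {1..n} \<and> s = val v (restrict_word n D @ shift_word k)"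
  by (auto simp: T_def)

text \<open>Cut both sets down to the points that the shift keeps in {1..n}; these are the domains,
  hence equal. A point of the common domain recovers the shift. If there is none, the shifts may
  differ, and only \<open>zero_z\<close> makes the values agree.\<close>

lemma val_translation_eqI:
  assumes "word_map n (restrict_word n C @ shift_word k) = word_map n (restrict_word n D @ shift_word l)"
  shows "val v (restrict_word n C @ shift_word k) = val v (restrict_word n D @ shift_word l)"
proof -
  define C' where "C' = {d \<in> {1..n} \<inter> C. 1 \<le> int d + k \<and> int d + k \<le> int n}"
  define D' where "D' = {d \<in> {1..n} \<inter> D. 1 \<le> int d + l \<and> int d + l \<le> int n}"
  have *: "(if d \<in> C' then Some (nat (int d + k)) else None) = (if d \<in> D' then Some (nat (int d + l)) else None)" for d
    using fun_cong[OF assms, of d] n by (simp add: word_map_translation C'_def D'_def)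
  then have eq: "C' = D'" by (auto split: if_splits) (metis option.distinct(1))+
  have restrict: "val v (restrict_word n C @ shift_word k) = pid C' * z k" "val v (restrict_word n D @ shift_word l) = pid D' * z l"
  proof -
    have "pid C' = pid (C \<inter> {d. 1 \<le> int d + k \<and> int d + k \<le> int n})"
      "pid D' = pid (D \<inter> {d. 1 \<le> int d + l \<and> int d + l \<le> int n})"
      by (intro pid_cong; auto simp: C'_def D'_def)+
    then show "val v (restrict_word n C @ shift_word k) = pid C' * z k" "val v (restrict_word n D @ shift_word l) = pid D' * z l"
      by (simp_all flip: pid_z_restrict)
  qed
  show ?thesis
  proof (cases "C' = {}")
    case True
    then show ?thesis using restrict eq zero_z by simp
  next
    case False
    then obtain d where "d \<in> C'" "d \<in> D'" using eq by auto
    then have "k = l" using *[of d] by (auto simp: C'_def D'_def)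
    then show ?thesis using restrict eq by simp
  qed
qed

text \<open>A normal form is known to have the same value as the word; that it also has the same map
  is supplied by \<open>rels\<close>. In the intended model this is soundness of evaluation.
  Distinct types of normal form have distinct maps, so only words of the same type remain to be
  compared.\<close>

lemma val_eq_if_word_map_eq:
  assumes rels: "\<And>u u'. u \<in> lists (alphabet n m) \<Longrightarrow> u' \<in> lists (alphabet n m) \<Longrightarrow>
      val v u = val v u' \<Longrightarrow> word_map n u = word_map n u'"
    and u: "u \<in> lists (alphabet n m)" "u' \<in> lists (alphabet n m)" and eq: "word_map n u = word_map n u'"
  shows "val v u = val v u'"
proof -
  define W where "W = {restrict_word n D @ shift_word k | D k. D \<subseteq> {1..n}} \<union> {flip_word n p i q | p i q. flip_ok n p i q}"
  have W: "\<exists>s\<in>W. s \<in> lists (alphabet n m) \<and> val v u = val v s \<and> word_map n u = word_map n s"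
    if u: "u \<in> lists (alphabet n m)" for u
  proof -
    from val_in_TF[OF u] have "\<exists>s\<in>W. val v u = val v s"
    proof
      assume "val v u \<in> T"
      from T_word_form[OF this] show ?thesis unfolding W_def by blast
    next
      assume "val v u \<in> F"
      then show ?thesis unfolding F_def W_def by blast
    qed
    then obtain s where s: "s \<in> W" "val v u = val v s" by blast
    have "W \<subseteq> lists (alphabet n m)"
      using flip_word_lists[of n, folded m] translation_lists unfolding W_def by blast
    with s have sl: "s \<in> lists (alphabet n m)" by blast
    show ?thesis
      using sl rels[OF u sl s(2)] s by (intro bexI[of _ s]) simp_all
  qed
  obtain s where s: "s \<in> W" "val v u = val v s" "word_map n u = word_map n s" using W[OF u(1)] by blast
  obtain s' where s': "s' \<in> W" "val v u' = val v s'" "word_map n u' = word_map n s'" using W[OF u(2)] by blast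
  have eq: "word_map n s = word_map n s'" using eq s(3) s'(3) by simp
  from s(1) s'(1) eq have "val v s = val v s'"
    unfolding W_def
  proof (elim UnE CollectE exE conjE; hypsubst)
    show "val v (restrict_word n D @ shift_word k) = val v (restrict_word n D' @ shift_word k')"
      if "word_map n (restrict_word n D @ shift_word k) = word_map n (restrict_word n D' @ shift_word k')" for D k D' k'
      using that by (rule val_translation_eqI)
    show "val v (restrict_word n D @ shift_word k) = val v (flip_word n p i q)"
      if "word_map n (restrict_word n D @ shift_word k) = word_map n (flip_word n p i q)" "flip_ok n p i q" for D k p i q
      using that word_map_translation_neq_flip_word by blast
    show "val v (flip_word n p i q) = val v (restrict_word n D @ shift_word k)"
      if "word_map n (flip_word n p i q) = word_map n (restrict_word n D @ shift_word k)" "flip_ok n p i q" for D k p i q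
      using that(1)[symmetric] that(2) word_map_translation_neq_flip_word by blast
    show "val v (flip_word n p i q) = val v (flip_word n p' i' q')"
      if "word_map n (flip_word n p i q) = word_map n (flip_word n p' i' q')" "flip_ok n p i q" "flip_ok n p' i' q'"
      for p i q p' i' q'
      by (rule arg_cong[OF flip_word_inj[OF that(2,3,1)]])
  qed
  then show ?thesis using s(2) s'(2) by simp
qed

end

section \<open>The elements of \<open>ODI n\<close>\<close>

lemma one_in_dihedral: "id \<in> dihedral n"
  using generate.one[of "sym_group n"] by (simp add: dihedral_def sym_group_one)

lemma dihedral_comp: "\<sigma> \<in> dihedral n \<Longrightarrow> \<tau> \<in> dihedral n \<Longrightarrow> \<sigma> \<circ> \<tau> \<in> dihedral n"
  using generate.eng[of \<sigma> "sym_group n" _ \<tau>] by (simp add: dihedral_def sym_group_mult)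

lemma cycle_in_dihedral: "cycle_perm n \<in> dihedral n"
  and reversal_in_dihedral: "reversal_perm n \<in> dihedral n"
  by (auto simp: dihedral_def intro: generate.incl)

section \<open>Dihedral permutations as rotations and reflections modulo n\<close>

lemma permutes_cycle_perm: "1 \<le> n \<Longrightarrow> cycle_perm n permutes {1..n}"
proof (rule bij_imp_permutes)
  assume "1 \<le> n"
  then show "bij_betw (cycle_perm n) {1..n} {1..n}"
    by (intro bij_betw_byWitness[where f' = "\<lambda>i. if i = 1 then n else i - 1"])
      (auto simp: cycle_perm_def split: if_splits)
qed (auto simp: cycle_perm_def)

lemma permutes_reversal_perm: "reversal_perm n permutes {1..n}"
proof (rule bij_imp_permutes)
  show "bij_betw (reversal_perm n) {1..n} {1..n}"
    by (rule bij_betw_byWitness[where f' = "reversal_perm n"]) (auto simp: reversal_perm_def)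
qed (auto simp: reversal_perm_def)

text \<open>Recording only residues avoids a case split for wraparound, and closure under
  composition and inverses becomes divisibility arithmetic.\<close>

definition rotation_mod :: "nat \<Rightarrow> (nat \<Rightarrow> nat) \<Rightarrow> bool" where
  "rotation_mod n \<sigma> \<longleftrightarrow> (\<exists>c. \<forall>i\<in>{1..n}. int n dvd int (\<sigma> i) - int i - c)"

definition reflection_mod :: "nat \<Rightarrow> (nat \<Rightarrow> nat) \<Rightarrow> bool" where
  "reflection_mod n \<sigma> \<longleftrightarrow> (\<exists>c. \<forall>i\<in>{1..n}. int n dvd int (\<sigma> i) + int i - c)"

lemma rotation_mod_cycle: "rotation_mod n (cycle_perm n)"
  unfolding rotation_mod_def by (rule exI[of _ 1]) (auto simp: cycle_perm_def)

lemma reflection_mod_reversal: "reflection_mod n (reversal_perm n)"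
  unfolding reflection_mod_def by (rule exI[of _ 1]) (auto simp: reversal_perm_def)

lemma rotation_or_reflection_comp:
  assumes \<tau>: "\<tau> permutes {1..n}"
    and "rotation_mod n \<sigma> \<or> reflection_mod n \<sigma>" "rotation_mod n \<tau> \<or> reflection_mod n \<tau>"
  shows "rotation_mod n (\<sigma> \<circ> \<tau>) \<or> reflection_mod n (\<sigma> \<circ> \<tau>)"
proof -
  have \<tau>_in: "\<tau> i \<in> {1..n}" if "i \<in> {1..n}" for i using \<tau> that by (simp only: permutes_in_image)
  \<comment> \<open>In each of the four cases the expression for the composite is the sum or the
    difference of the expressions for \<open>\<sigma>\<close> at \<open>\<tau> i\<close> and for
    \<open>\<tau>\<close> at \<open>i\<close>, with \<open>\<tau> i\<close> cancelling.\<close>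
  have add: "int n dvd c" if "int n dvd a" "int n dvd b" "c = a + b \<or> c = a - b" for a b c
    using that by (auto intro: dvd_add dvd_diff)
  from assms(2,3) show ?thesis
  proof (elim disjE)
    assume "rotation_mod n \<sigma>" "rotation_mod n \<tau>"
    then obtain c d where *: "\<forall>i\<in>{1..n}. int n dvd int (\<sigma> i) - int i - c"
      "\<forall>i\<in>{1..n}. int n dvd int (\<tau> i) - int i - d" by (auto simp: rotation_mod_def)
    have "\<forall>i\<in>{1..n}. int n dvd int ((\<sigma> \<circ> \<tau>) i) - int i - (c + d)"
    proof
      fix i assume i: "i \<in> {1..n}"
      show "int n dvd int ((\<sigma> \<circ> \<tau>) i) - int i - (c + d)"
        by (rule add[OF *(1)[rule_format, OF \<tau>_in[OF i]] *(2)[rule_format, OF i]]) simp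
    qed
    then show ?thesis unfolding rotation_mod_def by blast
  next
    assume "reflection_mod n \<sigma>" "rotation_mod n \<tau>"
    then obtain c d where *: "\<forall>i\<in>{1..n}. int n dvd int (\<sigma> i) + int i - c"
      "\<forall>i\<in>{1..n}. int n dvd int (\<tau> i) - int i - d" by (auto simp: rotation_mod_def reflection_mod_def)
    have "\<forall>i\<in>{1..n}. int n dvd int ((\<sigma> \<circ> \<tau>) i) + int i - (c - d)"
    proof
      fix i assume i: "i \<in> {1..n}"
      show "int n dvd int ((\<sigma> \<circ> \<tau>) i) + int i - (c - d)"
        by (rule add[OF *(1)[rule_format, OF \<tau>_in[OF i]] *(2)[rule_format, OF i]]) simp
    qed
    then show ?thesis unfolding reflection_mod_def by blast
  next
    assume "rotation_mod n \<sigma>" "reflection_mod n \<tau>"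
    then obtain c d where *: "\<forall>i\<in>{1..n}. int n dvd int (\<sigma> i) - int i - c"
      "\<forall>i\<in>{1..n}. int n dvd int (\<tau> i) + int i - d" by (auto simp: rotation_mod_def reflection_mod_def)
    have "\<forall>i\<in>{1..n}. int n dvd int ((\<sigma> \<circ> \<tau>) i) + int i - (c + d)"
    proof
      fix i assume i: "i \<in> {1..n}"
      show "int n dvd int ((\<sigma> \<circ> \<tau>) i) + int i - (c + d)"
        by (rule add[OF *(1)[rule_format, OF \<tau>_in[OF i]] *(2)[rule_format, OF i]]) simp
    qed
    then show ?thesis unfolding reflection_mod_def by blast
  next
    assume "reflection_mod n \<sigma>" "reflection_mod n \<tau>"
    then obtain c d where *: "\<forall>i\<in>{1..n}. int n dvd int (\<sigma> i) + int i - c"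
      "\<forall>i\<in>{1..n}. int n dvd int (\<tau> i) + int i - d" by (auto simp: reflection_mod_def)
    have "\<forall>i\<in>{1..n}. int n dvd int ((\<sigma> \<circ> \<tau>) i) - int i - (c - d)"
    proof
      fix i assume i: "i \<in> {1..n}"
      show "int n dvd int ((\<sigma> \<circ> \<tau>) i) - int i - (c - d)"
        by (rule add[OF *(1)[rule_format, OF \<tau>_in[OF i]] *(2)[rule_format, OF i]]) simp
    qed
    then show ?thesis unfolding rotation_mod_def by blast
  qed
qed

lemma rotation_or_reflection_inverse:
  assumes \<tau>: "\<tau> permutes {1..n}" "\<sigma> \<circ> \<tau> = id" and "rotation_mod n \<sigma> \<or> reflection_mod n \<sigma>"
  shows "rotation_mod n \<tau> \<or> reflection_mod n \<tau>"
proof -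
  have \<tau>_in: "\<tau> i \<in> {1..n}" if "i \<in> {1..n}" for i using \<tau> that by (simp only: permutes_in_image)
  have \<sigma>\<tau>: "\<sigma> (\<tau> i) = i" for i using \<tau>(2) by (metis comp_apply id_apply)
  from assms(3) show ?thesis
  proof
    assume "rotation_mod n \<sigma>"
    then obtain c where c: "\<forall>i\<in>{1..n}. int n dvd int (\<sigma> i) - int i - c" by (auto simp: rotation_mod_def)
    have "int n dvd int (\<tau> i) - int i - (- c)" if "i \<in> {1..n}" for i
    proof -
      have "int n dvd - (int (\<sigma> (\<tau> i)) - int (\<tau> i) - c)" using c \<tau>_in[OF that] by (simp only: dvd_minus_iff)
      then show ?thesis by (simp add: \<sigma>\<tau> algebra_simps)
    qed
    then show ?thesis unfolding rotation_mod_def by blast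
  next
    assume "reflection_mod n \<sigma>"
    then obtain c where c: "\<forall>i\<in>{1..n}. int n dvd int (\<sigma> i) + int i - c" by (auto simp: reflection_mod_def)
    have "int n dvd int (\<tau> i) + int i - c" if "i \<in> {1..n}" for i
      using c[rule_format, OF \<tau>_in[OF that]] by (simp add: \<sigma>\<tau> algebra_simps)
    then show ?thesis unfolding reflection_mod_def by blast
  qed
qed

lemma dihedral_cases:
  assumes n: "1 \<le> n" and "\<sigma> \<in> dihedral n"
  shows "\<sigma> permutes {1..n} \<and> (rotation_mod n \<sigma> \<or> reflection_mod n \<sigma>)"
  using assms(2) unfolding dihedral_def
proof (induction rule: generate.induct)
  case one
  have "rotation_mod n id" unfolding rotation_mod_def by (rule exI[of _ 0]) simp
  then show ?case using permutes_id by (metis sym_group_one)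
next
  case (incl h)
  then show ?case using permutes_cycle_perm[OF n] permutes_reversal_perm rotation_mod_cycle reflection_mod_reversal
    by blast
next
  case (inv h)
  interpret group "sym_group n" by (rule sym_group_is_group)
  have h: "h \<in> carrier (sym_group n)"
    using inv permutes_cycle_perm[OF n] permutes_reversal_perm by (auto simp: sym_group_carrier)
  have "h \<circ> (inv\<^bsub>sym_group n\<^esub> h) = id"
    using r_inv[OF h] by (simp only: sym_group_mult sym_group_one)
  moreover have "inv\<^bsub>sym_group n\<^esub> h permutes {1..n}"
    using inv_closed[OF h] by (simp only: sym_group_carrier)
  moreover have "rotation_mod n h \<or> reflection_mod n h"
    using inv rotation_mod_cycle reflection_mod_reversal by blast
  ultimately show ?case using rotation_or_reflection_inverse by blast
next
  case (eng h1 h2)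
  then show ?case
    using rotation_or_reflection_comp permutes_compose unfolding sym_group_mult by blast
qed

section \<open>The monoid structure and the images of the generators\<close>

lemma carrier_ODI:
  "carrier (ODI n) = {(Some \<circ> \<sigma>) |` S | \<sigma> S. \<sigma> \<in> dihedral n \<and> S \<subseteq> {1..n} \<and>
    (\<forall>a\<in>S. \<forall>b\<in>S. a \<le> b \<longrightarrow> \<sigma> a \<le> \<sigma> b)}"
proof -
  have "order_preserving ((Some \<circ> \<sigma>) |` S) \<longleftrightarrow> (\<forall>a\<in>S. \<forall>b\<in>S. a \<le> b \<longrightarrow> \<sigma> a \<le> \<sigma> b)" for \<sigma> S
    by (auto simp: order_preserving_def restrict_map_def dom_def)
  moreover have "carrier (ODI n) = {(Some \<circ> \<sigma>) |` S | \<sigma> S. \<sigma> \<in> dihedral n \<and> S \<subseteq> {1..n} \<and>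
      order_preserving ((Some \<circ> \<sigma>) |` S)}"
    unfolding ODI_def dihedral_inverse_monoid_def by simp blast
  ultimately show ?thesis by (simp only:)
qed

lemma mult_ODI: "\<alpha> \<otimes>\<^bsub>ODI n\<^esub> \<beta> = \<beta> \<circ>\<^sub>m \<alpha>"
  by (simp add: ODI_def dihedral_inverse_monoid_def sym_inv_monoid_def)

lemma one_ODI: "\<one>\<^bsub>ODI n\<^esub> = Some |` {1..n}"
  by (simp add: ODI_def dihedral_inverse_monoid_def sym_inv_monoid_def)

lemma mult_closed_ODI:
  assumes "\<alpha> \<in> carrier (ODI n)" "\<beta> \<in> carrier (ODI n)"
  shows "\<beta> \<circ>\<^sub>m \<alpha> \<in> carrier (ODI n)"
proof -
  obtain \<sigma> S where \<sigma>: "\<alpha> = (Some \<circ> \<sigma>) |` S" "\<sigma> \<in> dihedral n" "S \<subseteq> {1..n}"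
    "\<forall>a\<in>S. \<forall>b\<in>S. a \<le> b \<longrightarrow> \<sigma> a \<le> \<sigma> b" using assms(1) unfolding carrier_ODI by blast
  obtain \<tau> T where \<tau>: "\<beta> = (Some \<circ> \<tau>) |` T" "\<tau> \<in> dihedral n" "T \<subseteq> {1..n}"
    "\<forall>a\<in>T. \<forall>b\<in>T. a \<le> b \<longrightarrow> \<tau> a \<le> \<tau> b" using assms(2) unfolding carrier_ODI by blast
  have "\<tau> \<circ> \<sigma> \<in> dihedral n"
    using \<sigma>(2) \<tau>(2) by (intro dihedral_comp)
  moreover have "\<beta> \<circ>\<^sub>m \<alpha> = (Some \<circ> (\<tau> \<circ> \<sigma>)) |` {d \<in> S. \<sigma> d \<in> T}"
    by (auto simp: \<sigma> \<tau> map_comp_def restrict_map_def)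
  moreover have "{d \<in> S. \<sigma> d \<in> T} \<subseteq> {1..n}" using \<sigma> by blast
  moreover have "\<forall>a\<in>{d \<in> S. \<sigma> d \<in> T}. \<forall>b\<in>{d \<in> S. \<sigma> d \<in> T}. a \<le> b \<longrightarrow> (\<tau> \<circ> \<sigma>) a \<le> (\<tau> \<circ> \<sigma>) b"
    using \<sigma>(4) \<tau>(4) by simp
  ultimately show ?thesis unfolding carrier_ODI by blast
qed

lemma one_in_ODI: "Some |` {1..n} \<in> carrier (ODI n)"
  unfolding carrier_ODI using one_in_dihedral by force

lemma letter_map_in_ODI:
  assumes "a \<in> alphabet n ((n - 1) div 2)" "1 \<le> n"
  shows "letter_map n a \<in> carrier (ODI n)"
proof -
  have I: "letter_map n a \<in> carrier (ODI n)"
    if "letter_map n a = (Some \<circ> \<sigma>) |` S" "\<sigma> \<in> dihedral n" "S \<subseteq> {1..n}"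
      "\<And>a b. a \<in> S \<Longrightarrow> b \<in> S \<Longrightarrow> a \<le> b \<Longrightarrow> \<sigma> a \<le> \<sigma> b" for \<sigma> S
    using that unfolding carrier_ODI by blast
  \<comment> \<open>The composite sends d to n + 2 - d modulo n. It is the reflection fixing 1, and
    x_i and y_i are its restrictions to 1 and one further point.\<close>
  have flip: "cycle_perm n (reversal_perm n 1) = 1" "cycle_perm n (reversal_perm n (i + 1)) = n - i + 1"
    if "1 \<le> i" "i < n" for i
    using that by (auto simp: cycle_perm_def reversal_perm_def)
  consider "a = X" | "a = Y" | j where "j \<in> {1..n}" "a = E j"
    | i where "i \<in> {1..(n - 1) div 2}" "a = Xi i" | i where "i \<in> {1..(n - 1) div 2}" "a = Yi i"
    using assms by (auto simp: alphabet_def)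
  then show ?thesis
  proof cases
    case 1
    show ?thesis by (rule I[of "cycle_perm n" "{1..<n}"])
      (auto simp: 1 cycle_in_dihedral cycle_perm_def restrict_map_def)
  next
    case 2
    \<comment> \<open>Conjugating the cycle by the reversal gives the inverse of the cycle, which
      restricts to the map of y.\<close>
    show ?thesis
    proof (rule I[of "reversal_perm n \<circ> (cycle_perm n \<circ> reversal_perm n)" "{2..n}"])
      show "letter_map n a = (Some \<circ> (reversal_perm n \<circ> (cycle_perm n \<circ> reversal_perm n))) |` {2..n}"
        by (rule ext) (auto simp: 2 cycle_perm_def reversal_perm_def restrict_map_def)
    qed (auto simp: cycle_perm_def reversal_perm_def cycle_in_dihedral reversal_in_dihedral dihedral_comp)
  next
    case (3 j)
    show ?thesis by (rule I[of id "{1..n} - {j}"]) (auto simp: 3 one_in_dihedral restrict_map_def)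
  next
    case (4 i)
    show ?thesis
      by (rule I[of "cycle_perm n \<circ> reversal_perm n" "{1, i + 1}"])
        (use 4 flip[of i] in \<open>auto simp: fun_eq_iff restrict_map_def cycle_in_dihedral reversal_in_dihedral dihedral_comp\<close>)
  next
    case (5 i)
    then have "1 \<le> n - i" "n - i < n" "i < n" by auto
    then show ?thesis
      by (intro I[of "cycle_perm n \<circ> reversal_perm n" "{1, n - i + 1}"])
        (use 5 flip[of "n - i"] in \<open>auto simp: fun_eq_iff restrict_map_def cycle_in_dihedral reversal_in_dihedral dihedral_comp\<close>)
  qed
qed

lemma word_map_in_ODI:
  assumes "w \<in> lists (alphabet n ((n - 1) div 2))" "1 \<le> n"
  shows "word_map n w \<in> carrier (ODI n)"
  using assms(1)
proof (induction w)
  case Nil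
  then show ?case using one_in_ODI[of n] by simp
next
  case (Cons a w)
  then show ?case using letter_map_in_ODI[of a n] mult_closed_ODI assms(2) by simp
qed

lemma dom_ODI: "\<alpha> \<in> carrier (ODI n) \<Longrightarrow> dom \<alpha> \<subseteq> {1..n}"
  unfolding carrier_ODI by (auto simp: restrict_map_def split: if_splits)

lemma ran_ODI: assumes n: "1 \<le> n" and "\<alpha> \<in> carrier (ODI n)" shows "ran \<alpha> \<subseteq> {1..n}"
proof -
  obtain \<sigma> S where \<sigma>: "\<alpha> = (Some \<circ> \<sigma>) |` S" "\<sigma> \<in> dihedral n" "S \<subseteq> {1..n}"
    using assms(2) unfolding carrier_ODI by blast
  then have "ran \<alpha> = \<sigma> ` S" by (auto simp: ran_def restrict_map_def)
  moreover have "\<sigma> ` {1..n} = {1..n}" using dihedral_cases[OF n \<sigma>(2)] by (simp add: permutes_image)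
  ultimately show ?thesis using \<sigma>(3) by blast
qed

lemma monoid_ODI: assumes n: "1 \<le> n" shows "monoid (ODI n)"
proof (rule monoidI)
  fix \<alpha> \<beta> \<gamma> assume "\<alpha> \<in> carrier (ODI n)"
  show "\<one>\<^bsub>ODI n\<^esub> \<otimes>\<^bsub>ODI n\<^esub> \<alpha> = \<alpha>"
    using restrict_Some_comp[OF dom_ODI] \<open>\<alpha> \<in> carrier (ODI n)\<close> by (simp add: mult_ODI one_ODI)
  show "\<alpha> \<otimes>\<^bsub>ODI n\<^esub> \<one>\<^bsub>ODI n\<^esub> = \<alpha>"
  proof
    fix d
    show "(\<alpha> \<otimes>\<^bsub>ODI n\<^esub> \<one>\<^bsub>ODI n\<^esub>) d = \<alpha> d"
      using ran_ODI[OF n \<open>\<alpha> \<in> carrier (ODI n)\<close>]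
      by (cases "\<alpha> d") (auto simp: mult_ODI one_ODI map_comp_def ran_def restrict_map_def)
  qed
  show "\<alpha> \<otimes>\<^bsub>ODI n\<^esub> \<beta> \<otimes>\<^bsub>ODI n\<^esub> \<gamma> = \<alpha> \<otimes>\<^bsub>ODI n\<^esub> (\<beta> \<otimes>\<^bsub>ODI n\<^esub> \<gamma>)"
    by (auto simp: mult_ODI map_comp_def split: option.splits)
qed (use one_in_ODI in \<open>simp_all add: mult_ODI one_ODI mult_closed_ODI\<close>)

section \<open>Every element is the value of a word\<close>

lemma dvd_small: "int n dvd c \<Longrightarrow> - int n < c \<Longrightarrow> c < int n \<Longrightarrow> c = 0"
  using zdvd_imp_le[of "int n" c] zdvd_imp_le[of "int n" "- c"] by force

lemma translation_word_surj:
  assumes S: "S \<subseteq> {1..n}" "\<sigma> ` S \<subseteq> {1..n}"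
    and k: "\<And>d. d \<in> S \<Longrightarrow> int (\<sigma> d) = int d + k"
  shows "(Some \<circ> \<sigma>) |` S = word_map n (restrict_word n S @ shift_word k)"
proof
  fix d
  have "nat (int d + k) = \<sigma> d \<and> \<sigma> d \<in> {1..n} \<and> d \<in> {1..n}" if "d \<in> S"
    using k[OF that] that S by (metis image_subset_iff nat_int subsetD)
  then show "((Some \<circ> \<sigma>) |` S) d = word_map n (restrict_word n S @ shift_word k) d"
    using k[of d] by (auto simp: word_map_translation restrict_map_def)
qed

lemma word_map_surj:
  assumes n: "1 \<le> n" and "\<alpha> \<in> carrier (ODI n)"
  shows "\<exists>w \<in> lists (alphabet n ((n - 1) div 2)). word_map n w = \<alpha>" (is ?thesis)
proof -
  obtain \<sigma> S where \<alpha>: "\<alpha> = (Some \<circ> \<sigma>) |` S" and \<sigma>: "\<sigma> \<in> dihedral n" and S: "S \<subseteq> {1..n}"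
    and mono: "\<And>a b. a \<in> S \<Longrightarrow> b \<in> S \<Longrightarrow> a \<le> b \<Longrightarrow> \<sigma> a \<le> \<sigma> b"
    using assms(2) unfolding carrier_ODI by blast
  have perm: "\<sigma> permutes {1..n}" and mod: "rotation_mod n \<sigma> \<or> reflection_mod n \<sigma>"
    using dihedral_cases[OF n \<sigma>] by auto
  have \<sigma>S: "\<sigma> ` S \<subseteq> {1..n}" using S permutes_image[OF perm] by blast
  have in_S: "1 \<le> a \<and> a \<le> n \<and> 1 \<le> \<sigma> a \<and> \<sigma> a \<le> n" if "a \<in> S" for a
    using S \<sigma>S that by auto
  have less: "\<sigma> a < \<sigma> b" if "a \<in> S" "b \<in> S" "a < b" for a b
    using mono[of a b] that permutes_inj[OF perm] by (metis injD le_neq_implies_less less_imp_le not_less_iff_gr_or_eq)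
  have translation: ?thesis if "\<And>d. d \<in> S \<Longrightarrow> int (\<sigma> d) = int d + k" for k
    by (rule bexI[OF _ translation_lists]) (use translation_word_surj[OF S \<sigma>S that] \<alpha> in simp)
  from mod show ?thesis
  proof
    assume "rotation_mod n \<sigma>"
    then obtain c where c: "\<And>i. i \<in> S \<Longrightarrow> int n dvd int (\<sigma> i) - int i - c"
      using S by (auto simp: rotation_mod_def)
    have diff: "int (\<sigma> b) - int b = int (\<sigma> a) - int a" if "a \<in> S" "b \<in> S" "a < b" for a b
    proof -
      have "int n dvd (int (\<sigma> b) - int b - c) - (int (\<sigma> a) - int a - c)"
        by (rule dvd_diff[OF c[OF that(2)] c[OF that(1)]])
      then have "int n dvd int (\<sigma> b) - int b - (int (\<sigma> a) - int a)" by (simp add: algebra_simps)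
      \<comment> \<open>Both b - a and the distance of the images lie strictly between 0 and n, so
        their difference is less than n in absolute value.\<close>
      then have "int (\<sigma> b) - int b - (int (\<sigma> a) - int a) = 0"
        by (rule dvd_small) (use less[OF that] in_S[OF that(1)] in_S[OF that(2)] that(3) in linarith)+
      then show ?thesis by simp
    qed
    show ?thesis
    proof (cases "S = {}")
      case True
      then show ?thesis by (intro translation[of 0]) auto
    next
      case False
      then obtain a where a: "a \<in> S" by blast
      show ?thesis
      proof (rule translation[of "int (\<sigma> a) - int a"])
        fix d assume "d \<in> S"
        then show "int (\<sigma> d) = int d + (int (\<sigma> a) - int a)"
          using diff[of a d] diff[of d a] a by (cases a d rule: linorder_cases) auto
      qed
    qed
  next
    assume "reflection_mod n \<sigma>"
    then obtain c where c: "\<And>i. i \<in> S \<Longrightarrow> int n dvd int (\<sigma> i) + int i - c"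
      using S by (auto simp: reflection_mod_def)
    have diff: "\<sigma> b + b = n + \<sigma> a + a" if "a \<in> S" "b \<in> S" "a < b" for a b
    proof -
      have "int n dvd (int (\<sigma> b) + int b - c) - (int (\<sigma> a) + int a - c)"
        by (rule dvd_diff[OF c[OF that(2)] c[OF that(1)]])
      \<comment> \<open>The sums of point and image differ by a multiple of n strictly between 0 and
        2n. Subtracting n brings it into the range of \<open>dvd_small\<close>.\<close>
      then have "int n dvd (int (\<sigma> b) + int b - c) - (int (\<sigma> a) + int a - c) - int n"
        by (rule dvd_diff) simp
      then have "int n dvd int (\<sigma> b) + int b - (int (\<sigma> a) + int a) - int n" by (simp add: algebra_simps)
      then have "int (\<sigma> b) + int b - (int (\<sigma> a) + int a) - int n = 0"
        by (rule dvd_small) (use less[OF that] in_S[OF that(1)] in_S[OF that(2)] that(3) in linarith)+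
      then show ?thesis by simp
    qed
    show ?thesis
    proof (cases "\<exists>a b. a \<in> S \<and> b \<in> S \<and> a < b")
      case False
      then have *: "a = d" if "a \<in> S" "d \<in> S" for a d using that by (metis linorder_neqE_nat)
      show ?thesis
      proof (cases "S = {}")
        case True
        then show ?thesis by (intro translation[of 0]) auto
      next
        case False
        then obtain a where a: "a \<in> S" by blast
        show ?thesis
        proof (rule translation)
          show "int (\<sigma> d) = int d + (int (\<sigma> a) - int a)" if "d \<in> S" for d
            using *[OF a that] by simp
        qed
      qed
    next
      case True
      then obtain a b where ab: "a \<in> S" "b \<in> S" "a < b" by blast
      \<comment> \<open>For three points in increasing order, adding \<open>diff\<close> for the two
        neighbouring pairs contradicts \<open>diff\<close> for the outer pair.\<close>
      have "d = a \<or> d = b" if "d \<in> S" for d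
      proof (rule ccontr)
        assume "\<not> (d = a \<or> d = b)"
        then consider "d < a" | "a < d" "d < b" | "b < d" using ab(3) by linarith
        then show False
          using diff[OF ab] diff[of d a] diff[of d b] diff[of a d] diff[of b d] ab that
            in_S[OF ab(1)] in_S[OF ab(2)] in_S[OF that] by cases linarith+
      qed
      then have Sab: "S = {a, b}" using ab by auto
      show ?thesis
      proof (cases "2 * (b - a) = n")
        case True
        \<comment> \<open>The images are at distance n - (b - a) = b - a, so both points are moved
          by the same amount.\<close>
        then show ?thesis
          by (intro translation[of "int (\<sigma> a) - int a"]) (use Sab diff[OF ab] ab(3) in auto)
      next
        case False
        \<comment> \<open>The condition q < i amounts to \<open>\<sigma> b \<le> n\<close>, as
          \<open>diff\<close> gives \<open>\<sigma> b = n + \<sigma> a - (b - a)\<close>.\<close>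
        have ok: "flip_ok n (a - 1) (b - a) (\<sigma> a - 1)"
          using False diff[OF ab] ab(3) in_S[OF ab(1)] in_S[OF ab(2)] unfolding flip_ok_def by linarith
        have "word_map n (flip_word n (a - 1) (b - a) (\<sigma> a - 1)) = [a \<mapsto> \<sigma> a, b \<mapsto> \<sigma> b]"
        proof -
          have "a - 1 + 1 = a" "\<sigma> a - 1 + 1 = \<sigma> a" "a - 1 + (b - a) + 1 = b" "n - (b - a) + (\<sigma> a - 1) + 1 = \<sigma> b"
            using diff[OF ab] ab(3) in_S[OF ab(1)] in_S[OF ab(2)] by linarith+
          then show ?thesis unfolding word_map_flip_word[OF ok] by (simp only:)
        qed
        also have "\<dots> = \<alpha>" using ab(3) by (auto simp: \<alpha> Sab restrict_map_def)
        finally show ?thesis using flip_word_lists[OF ok] by blast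
      qed
    qed
  qed
qed

section \<open>Counting letters and relations\<close>

lemma card_alphabet: "card (alphabet n m) = n + 2 * m + 2"
proof -
  have "alphabet n m = insert X (insert Y (E ` {1..n} \<union> (Xi ` {1..m} \<union> Yi ` {1..m})))"
    by (auto simp: alphabet_def)
  moreover have "card (E ` {1..n} \<union> (Xi ` {1..m} \<union> Yi ` {1..m})) = n + (m + m)"
    by (subst card_Un_disjoint; (subst card_Un_disjoint)?) (auto simp: card_image inj_on_def)
  ultimately show ?thesis by (simp add: image_iff)
qed

text \<open>The left-hand sides of the relations are pairwise distinct, so it suffices to count them.\<close>

fun rel_rhs :: "nat \<Rightarrow> letter list \<Rightarrow> letter list" where
  "rel_rhs n [E i, E j] = (if i = j then [E i] else [E j, E i])"
| "rel_rhs n [X, Y] = [E n]"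
| "rel_rhs n [Y, X] = [E 1]"
| "rel_rhs n [X, E i] = [X]"
| "rel_rhs n [E i, Y] = [Y]"
| "rel_rhs n [E i, X] = [X, E (i + 1)]"
| "rel_rhs n [Xi i, Yi j] = es 2 i @ es (i + 2) n"
| "rel_rhs n [Yi i, Xi j] = es 2 (n - i) @ es (n - i + 2) n"
| "rel_rhs n [Xi i, E j] =
    (if j = 1 then replicate (n - 2 * i) X @ es (n - 2 * i + 1) (n - i) @ es (n - i + 2) n
     else if j = n - i + 1 then [E (i + 1), Xi i] else [Xi i])"
| "rel_rhs n [E j, Xi i] =
    (if j = 1 then [Xi i, E 1] else if j = i + 1 then [Yi i, E (i + 1)] else [Xi i])"
| "rel_rhs n [Yi i, E j] =
    (if j = 1 then replicate (n - 2 * i) Y @ es 1 i @ es (i + 2) (2 * i)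
     else if j = i + 1 then [E (n - i + 1), Yi i] else [Yi i])"
| "rel_rhs n [E j, Yi i] =
    (if j = 1 then [Yi i, E 1] else if j = n - i + 1 then es 2 n else [Yi i])"
| "rel_rhs n w = es 1 n"

lemma es_Cons: "a \<le> b \<Longrightarrow> es a b = E a # es (a + 1) b"
  by (simp add: es_def upt_conv_Cons del: upt_Suc)

lemma inj_on_fst_relations:
  assumes "4 \<le> n" "m = (n - 1) div 2"
  shows "inj_on fst (relations n m)"
proof -
  \<comment> \<open>Two visible letters show that \<open>X # es 2 n\<close> is longer than two and
    so reaches the last clause of \<open>rel_rhs\<close>, not the one for
    \<open>[X, E i]\<close>.\<close>
  have es: "es 2 n = E 2 # E 3 # es 4 n"
    using assms es_Cons[of 2 n] es_Cons[of 3 n] by simp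
  have *: "w = rel_rhs n u" if "(u, w) \<in> relations n m" for u w
  proof -
    have half: "i \<le> m \<longleftrightarrow> 2 * i < n" for i
      using assms by auto
    consider "(u, w) \<in> R1 n" | "(u, w) \<in> R2 n" | "(u, w) \<in> R3" | "(u, w) \<in> R4 n" | "(u, w) \<in> R5 n"
      | "(u, w) \<in> R6 n m" | "(u, w) \<in> R7 n m" | "(u, w) \<in> R8 n m" | "(u, w) \<in> R9 n m"
      | "(u, w) \<in> R10 n m" | "(u, w) \<in> R11 n"
      using \<open>(u, w) \<in> relations n m\<close> unfolding relations_def by blast
    then show ?thesis
    proof cases
      case 10
      then show ?thesis unfolding R10_def by (auto simp: half)
    next
      case 11
      then show ?thesis unfolding R11_def by (auto simp: es)
    qed (auto simp: R1_def R2_def R3_def R4_def R5_def R6_def R7_def R8_def R9_def)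
  qed
  show ?thesis
  proof (rule inj_onI)
    fix p q assume "p \<in> relations n m" "q \<in> relations n m" "fst p = fst q"
    then show "p = q" using * by (metis prod.collapse)
  qed
qed

text \<open>\<open>R7\<close> to \<open>R10\<close> together form a full table: for each i, each j
  in {1..n} and each of the four products of x_i or y_i with e_j there is one relation.
  \<open>R9\<close> covers j = 1, \<open>R10\<close> the other point of the domain or image,
  \<open>R7\<close> and \<open>R8\<close> the rest. Likewise \<open>R1\<close> and \<open>R4\<close>
  fill the pairs i \<le> j.\<close>

lemma fst_relations:
  assumes "1 \<le> n" "m < n"
  shows "fst ` relations n m =
    (\<lambda>(j, i). [E i, E j]) ` (SIGMA j:{1..n}. {1..j}) \<union>
    ({[X, Y], [Y, X], [X, E 1], [E 1, Y]} \<union>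
    ((\<lambda>i. [E i, X]) ` {1..n - 1} \<union>
    ((\<lambda>i. [Xi i, Yi i]) ` {1..m} \<union>
    ((\<lambda>i. [Yi i, Xi i]) ` {1..m} \<union>
    ((\<lambda>(i, j). [Xi i, E j]) ` ({1..m} \<times> {1..n}) \<union>
    ((\<lambda>(i, j). [E j, Xi i]) ` ({1..m} \<times> {1..n}) \<union>
    ((\<lambda>(i, j). [Yi i, E j]) ` ({1..m} \<times> {1..n}) \<union>
    ((\<lambda>(i, j). [E j, Yi i]) ` ({1..m} \<times> {1..n}) \<union>
    {X # es 2 n}))))))))" (is "_ = ?EE \<union> (?XY \<union> (?EX \<union> (?c1 \<union> (?c2 \<union> (?c3 \<union> (?c4 \<union> (?c5 \<union> (?c6 \<union> ?z))))))))")
proof -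
  have EE: "fst ` R1 n \<union> fst ` R4 n = ?EE"
  proof (intro equalityI subsetI)
    fix u assume "u \<in> ?EE"
    then obtain i j where ij: "1 \<le> i" "i \<le> j" "j \<le> n" "u = [E i, E j]" by auto
    show "u \<in> fst ` R1 n \<union> fst ` R4 n"
    proof (cases "i = j")
      case True
      then have "(u, [E i]) \<in> R1 n" unfolding R1_def using ij by auto
      then show ?thesis by (force intro: rev_image_eqI)
    next
      case False
      then have "(u, [E j, E i]) \<in> R4 n" unfolding R4_def using ij by auto
      then show ?thesis by (force intro: rev_image_eqI)
    qed
  qed (force simp: R1_def R4_def)
  have XY: "fst ` R2 n \<union> fst ` R3 = ?XY"
    unfolding R2_def R3_def by auto
  have EX: "fst ` R5 n = ?EX"
    unfolding R5_def by (auto simp: image_iff)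
  have c12: "fst ` R6 n m = ?c1 \<union> ?c2"
    unfolding R6_def image_Un by (intro arg_cong2[of _ _ _ _ "(\<union>)"]) (force simp: image_iff)+
  have c: "fst ` (R7 n m \<union> R8 n m \<union> R9 n m \<union> R10 n m) = ?c3 \<union> (?c4 \<union> (?c5 \<union> ?c6))"
  proof (intro equalityI subsetI)
    fix u assume "u \<in> fst ` (R7 n m \<union> R8 n m \<union> R9 n m \<union> R10 n m)"
    then obtain w where "(u, w) \<in> R7 n m \<union> R8 n m \<union> R9 n m \<union> R10 n m"
      by (metis imageE prod.collapse)
    then have "\<exists>i j. 1 \<le> i \<and> i \<le> m \<and> 1 \<le> j \<and> j \<le> n \<and>
        (u = [Xi i, E j] \<or> u = [E j, Xi i] \<or> u = [Yi i, E j] \<or> u = [E j, Yi i])"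
      using assms unfolding R7_def R8_def R9_def R10_def by auto
    then show "u \<in> ?c3 \<union> (?c4 \<union> (?c5 \<union> ?c6))" by force
  next
    fix u assume "u \<in> ?c3 \<union> (?c4 \<union> (?c5 \<union> ?c6))"
    then obtain i j where ij: "1 \<le> i" "i \<le> m" "1 \<le> j" "j \<le> n" and
      u: "u = [Xi i, E j] \<or> u = [E j, Xi i] \<or> u = [Yi i, E j] \<or> u = [E j, Yi i]" by force
    have R7: "j \<noteq> 1 \<Longrightarrow> j \<noteq> n - i + 1 \<Longrightarrow> ([Xi i, E j], [Xi i]) \<in> R7 n m \<and> ([E j, Yi i], [Yi i]) \<in> R7 n m"
      using ij by (simp add: R7_def)
    have R8: "j \<noteq> 1 \<Longrightarrow> j \<noteq> i + 1 \<Longrightarrow> ([E j, Xi i], [Xi i]) \<in> R8 n m \<and> ([Yi i, E j], [Yi i]) \<in> R8 n m"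
      using ij by (simp add: R8_def)
    have R9: "\<exists>w. ([Xi i, E 1], w) \<in> R9 n m" "\<exists>w. ([E 1, Xi i], w) \<in> R9 n m"
      "\<exists>w. ([Yi i, E 1], w) \<in> R9 n m" "\<exists>w. ([E 1, Yi i], w) \<in> R9 n m"
      using ij by (simp_all add: R9_def)
    have R10: "\<exists>w. ([Xi i, E (n - i + 1)], w) \<in> R10 n m" "\<exists>w. ([E (i + 1), Xi i], w) \<in> R10 n m"
      "\<exists>w. ([Yi i, E (i + 1)], w) \<in> R10 n m" "\<exists>w. ([E (n - i + 1), Yi i], w) \<in> R10 n m"
      using ij by (simp_all add: R10_def)
    have "\<exists>w. (u, w) \<in> R7 n m \<union> R8 n m \<union> R9 n m \<union> R10 n m"
      using u
    proof (elim disjE)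
      assume "u = [Xi i, E j]"
      then show ?thesis using R7 R9(1) R10(1) by (cases "j = 1"; cases "j = n - i + 1") blast+
    next
      assume "u = [E j, Xi i]"
      then show ?thesis using R8 R9(2) R10(2) by (cases "j = 1"; cases "j = i + 1") blast+
    next
      assume "u = [Yi i, E j]"
      then show ?thesis using R8 R9(3) R10(3) by (cases "j = 1"; cases "j = i + 1") blast+
    next
      assume "u = [E j, Yi i]"
      then show ?thesis using R7 R9(4) R10(4) by (cases "j = 1"; cases "j = n - i + 1") blast+
    qed
    then show "u \<in> fst ` (R7 n m \<union> R8 n m \<union> R9 n m \<union> R10 n m)" by (metis fst_conv imageI)
  qed
  have z: "fst ` R11 n = ?z" unfolding R11_def by simp
  have "fst ` relations n m = (fst ` R1 n \<union> fst ` R4 n) \<union> ((fst ` R2 n \<union> fst ` R3) \<union> (fst ` R5 n \<union>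
    (fst ` R6 n m \<union> (fst ` (R7 n m \<union> R8 n m \<union> R9 n m \<union> R10 n m) \<union> fst ` R11 n))))"
    unfolding relations_def image_Un by (simp only: Un_ac)
  then show ?thesis unfolding EE XY EX c12 c z by (simp only: Un_assoc)
qed

text \<open>Doubling avoids division in the number n(n + 1)/2 of pairs i \<le> j. The term 4mn
  counts the table formed by \<open>R7\<close> to \<open>R10\<close>.\<close>

lemma card_relations:
  assumes "4 \<le> n" "m = (n - 1) div 2"
  shows "2 * card (relations n m) = n * (n + 1) + 2 * (n + 4 + 2 * m + 4 * m * n)"
proof -
  have es: "es 2 n = E 2 # E 3 # es 4 n"
    using assms es_Cons[of 2 n] es_Cons[of 3 n] by simp
  have pairs: "card ((\<lambda>(j, i). [E i, E j]) ` (SIGMA j:{1..n}. {1..j})) = (\<Sum>j=1..n. j)"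
    by (subst card_image) (auto simp: inj_on_def)
  have step: "card (U \<union> V) = a + b"
    if "card U = a" "card V = b" "finite U" "finite V" "U \<inter> V = {}" for U V :: "letter list set" and a b
    using that by (simp add: card_Un_disjoint)
  have gauss: "2 * (\<Sum>j=1..n. j) = n * (n + 1)"
    by (induction n) auto
  have "card (relations n m) = card (fst ` relations n m)"
    using card_image[OF inj_on_fst_relations[OF assms]] by simp
  also have "\<dots> = (\<Sum>j=1..n. j) + (4 + (n - 1 + (m + (m + (m * n + (m * n + (m * n + (m * n + 1))))))))"
  proof -
    have mn: "1 \<le> n" "m < n" using assms by auto
    show ?thesis
      unfolding fst_relations[OF mn] by (intro step pairs) (auto simp: card_image inj_on_def es)
  qed
  finally show ?thesis using gauss assms by (simp add: algebra_simps)
qed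

section \<open>The presentation\<close>

lemma ODI_presentation:
  assumes n: "4 \<le> n" and m: "m = (n - 1) div 2"
  shows "defined_by_presentation (ODI n) (alphabet n m) (relations n m)"
proof -
  define A where "A = alphabet n m"
  define r where "r = generated_congruence (free_monoid A) (relations n m)"
  have R: "relations n m \<subseteq> lists A \<times> lists A"
    unfolding A_def m by (rule relations_lists[OF n])
  have r: "monoid_congruence (free_monoid A) r"
    unfolding r_def by (rule monoid_congruence_generated[OF R])
  have dom: "dom (word_map n w) \<subseteq> {1..n}" if "w \<in> lists A" for w
    using dom_word_map[of w n] that n unfolding A_def m by simp
  have mult: "word_map n (u @ w) = word_map n u \<otimes>\<^bsub>ODI n\<^esub> word_map n w" if "w \<in> lists A" for u w
    using word_map_append[OF dom[OF that]] by (simp add: mult_ODI)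
  \<comment> \<open>For this valuation, equality of values is membership in \<open>r\<close>, so
    results of the locale become statements about the congruence.\<close>
  interpret ODI_model n m "right_mult A r"
  proof
    fix u w assume "(u, w) \<in> relations n m"
    then show "val (right_mult A r) u = val (right_mult A r) w"
      using R generated_congruence_subset[of "relations n m" "free_monoid A"] r_def
      by (subst val_right_mult_eq_iff[OF r]) auto
  qed (fact n m)+
  \<comment> \<open>The kernel of evaluation is a congruence containing the relations, so minimality
    of \<open>r\<close> gives soundness; the same inclusion discharges the premise
    \<open>rels\<close> below.\<close>
  define K where "K = {(u, w). u \<in> lists A \<and> w \<in> lists A \<and> word_map n u = word_map n w}"
  have "monoid_congruence (free_monoid A) K"
    unfolding monoid_congruence_def
  proof (intro conjI equivI allI impI)
    show "(a \<otimes>\<^bsub>free_monoid A\<^esub> c, b \<otimes>\<^bsub>free_monoid A\<^esub> d) \<in> K" if "(a, b) \<in> K \<and> (c, d) \<in> K" for a b c d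
      using that mult[of c a] mult[of d b] by (simp add: K_def)
  qed (auto simp: K_def refl_on_def sym_def trans_def)
  moreover have "relations n m \<subseteq> K"
    using R word_map_relations[OF n] unfolding K_def m by blast
  ultimately have rK: "r \<subseteq> K" unfolding r_def by (rule generated_congruence_least)
  have ker: "word_map n u = word_map n w \<longleftrightarrow> (u, w) \<in> r" if uw: "u \<in> lists A" "w \<in> lists A" for u w
  proof
    assume eq: "word_map n u = word_map n w"
    have "val (right_mult A r) u = val (right_mult A r) w"
    proof (rule val_eq_if_word_map_eq[OF _ _ _ eq])
      show "word_map n s = word_map n t"
        if "s \<in> lists (alphabet n m)" "t \<in> lists (alphabet n m)" "val (right_mult A r) s = val (right_mult A r) t" for s t
        using that val_right_mult_eq_iff[OF r, of s t] rK by (auto simp: K_def simp flip: A_def)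
    qed (use uw in \<open>simp_all flip: A_def\<close>)
    then show "(u, w) \<in> r" using val_right_mult_eq_iff[OF r uw] by simp
  next
    assume "(u, w) \<in> r"
    then show "word_map n u = word_map n w" using rK by (auto simp: K_def)
  qed
  have "defined_by_presentation (ODI n) A (relations n m)"
  proof (rule defined_by_presentationI)
    show "monoid (ODI n)" using n by (intro monoid_ODI) simp
    show "word_map n ` lists A = carrier (ODI n)"
      using word_map_in_ODI[of _ n] word_map_surj[of n] n unfolding A_def m by auto
  qed (use R mult ker r_def in auto)
  then show ?thesis by (simp add: A_def)
qed

theorem theorem3p8:
  fixes n m :: nat
  assumes "n \<ge> 4"
    and "m = nat \<lfloor>(real n - 1) / 2\<rfloor>"
  shows "real (card (alphabet n m)) = 2 * real n + (1 - (-1) ^ n) / 2 \<and>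
    real (card (relations n m)) =
      1 / 2 * (5 * (real n)\<^sup>2 - (1 + 2 * (-1) ^ n) * real n + (-1) ^ (n + 1) + 5) \<and>
    defined_by_presentation (ODI n) (alphabet n m) (relations n m)"
proof -
  have "(real n - 1) / 2 = real (n - 1) / real 2" using assms(1) by simp
  then have m: "m = (n - 1) div 2"
    unfolding assms(2) by (simp only: floor_divide_of_nat_eq nat_int)
  have "real (2 * card (relations n m)) = real (n * (n + 1) + 2 * (n + 4 + 2 * m + 4 * m * n))"
    by (simp only: card_relations[OF assms(1) m])
  then have rels: "real (card (relations n m)) =
      (real n * (real n + 1) + 2 * (real n + 4 + 2 * real m + 4 * real m * real n)) / 2"
    by (simp add: algebra_simps)
  have "real (card (alphabet n m)) = 2 * real n + (1 - (-1) ^ n) / 2 \<and>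
    real (card (relations n m)) =
      1 / 2 * (5 * (real n)\<^sup>2 - (1 + 2 * (-1) ^ n) * real n + (-1) ^ (n + 1) + 5)"
  proof (cases "even n")
    case True
    then obtain k where k: "n = 2 * k" by blast
    \<comment> \<open>For even n, m is one less than n/2; the shifted parameter j expresses this
      without subtraction.\<close>
    then obtain j where "n = 2 * j + 2" "m = j"
      using m assms(1) by (intro that[of "k - 1"]) auto
    then show ?thesis using rels by (simp add: card_alphabet power2_eq_square algebra_simps)
  next
    case False
    then obtain k where k: "n = 2 * k + 1" by (auto elim: oddE)
    then have "m = k" using m by simp
    then show ?thesis using rels k by (simp add: card_alphabet power2_eq_square algebra_simps)
  qed
  then show ?thesis using ODI_presentation[OF assms(1) m] by simp
qed

end
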